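(* Let $E$ be a reflexive Banach space, $T>0$, $I=[0,T]$, and let $f\colon E\to E$, $g\colon I\times E\to E$ satisfy: (C1) $f$ is sequentially weakly continuous; (C2) $f$ is $1$-Lipschitz and differentiable; (C3) $\|u\|\le\|u-(f(u)-f(0))\|$ for all $u\in E$, and $\|w\|\le\|w-Df(u)w\|$ for all $w,u\in E$; (C4) $g$ is a weak Carathéodory map; (C5) $g$ has polynomial growth, i.e. $\|g(s,u)\|\le C\cdot(\|u\|^r+1)$ for some constants $C>0$ and $r\ge 0$; (C6) there exists $R>\|f(0)\|$ such that $C\cdot(T^r+1)=\dfrac{R-\|f(0)\|}{R^r+1}$. Then the equation $$u(t)=f(u(t))+\int_0^t g(s,u(s))\,ds,\qquad t\in I,$$ has at least one Lipschitz solution $u\colon I\to E$. Such a solution is almost everywhere differentiable.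
   Context: $Df(u)$ denotes the derivative of $f$ at $u$. A map $g\colon I\times E\to E$ is a weak Carathéodory map if for each fixed $x\in E$ the map $t\mapsto g(t,x)$ is measurable and for almost every $t\in I$ the map $x\mapsto g(t,x)$ is sequentially weakly continuous (i.e. $x_n\rightharpoonup x$ implies $g(t,x_n)\rightharpoonup g(t,x)$). *)

theory Defs
  imports "HOL-Analysis.Analysis"
begin

definition weakly_tendsto :: "(nat \<Rightarrow> 'a::real_normed_vector) \<Rightarrow> 'a \<Rightarrow> bool" where
  "weakly_tendsto xs x \<longleftrightarrow>
     (\<forall>\<phi> :: 'a \<Rightarrow>\<^sub>L real. (\<lambda>n. blinfun_apply \<phi> (xs n)) \<longlonglongrightarrow> blinfun_apply \<phi> x)"

definition seq_weakly_continuous ::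
  "('a::real_normed_vector \<Rightarrow> 'b::real_normed_vector) \<Rightarrow> bool" where
  "seq_weakly_continuous h \<longleftrightarrow>
     (\<forall>xs x. weakly_tendsto xs x \<longrightarrow> weakly_tendsto (\<lambda>n. h (xs n)) (h x))"

text \<open>Reflexivity: the canonical embedding into the bidual is onto.\<close>

definition reflexive_space :: "'a::real_normed_vector itself \<Rightarrow> bool" where
  "reflexive_space _ \<longleftrightarrow>
     (\<forall>\<Phi> :: ('a \<Rightarrow>\<^sub>L real) \<Rightarrow>\<^sub>L real. \<exists>x :: 'a.
        \<forall>\<phi> :: 'a \<Rightarrow>\<^sub>L real. blinfun_apply \<Phi> \<phi> = blinfun_apply \<phi> x)"

text \<open>The library's Bochner integral is restricted to second countable codomains. The two
  definitions below follow it for arbitrary normed spaces, with strong (Bochner) measurability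
  in place of Borel measurability; for separable codomains and complete measures the two notions
  of measurability agree.\<close>

definition strongly_measurable ::
  "'b measure \<Rightarrow> ('b \<Rightarrow> 'a::real_normed_vector) \<Rightarrow> bool" where
  "strongly_measurable M h \<longleftrightarrow>
     (\<exists>s :: nat \<Rightarrow> 'b \<Rightarrow> 'a. (\<forall>n. simple_function M (s n)) \<and>
        (AE t in M. (\<lambda>n. s n t) \<longlonglongrightarrow> h t))"

definition has_strong_bochner_integral ::
  "'b measure \<Rightarrow> ('b \<Rightarrow> 'a::real_normed_vector) \<Rightarrow> 'a \<Rightarrow> bool" where
  "has_strong_bochner_integral M h J \<longleftrightarrow>
     strongly_measurable M h \<and>
     (\<exists>s :: nat \<Rightarrow> 'b \<Rightarrow> 'a. (\<forall>n. Bochner_Integration.simple_bochner_integrable M (s n)) \<and>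
        (\<lambda>n. \<integral>\<^sup>+t. ennreal (norm (h t - s n t)) \<partial>M) \<longlonglongrightarrow> 0 \<and>
        (\<lambda>n. Bochner_Integration.simple_bochner_integral M (s n)) \<longlonglongrightarrow> J)"

text \<open>Maps on a set \<open>I\<close> are total functions whose values outside \<open>I\<close> are irrelevant.\<close>

definition weak_Caratheodory ::
  "real set \<Rightarrow> (real \<Rightarrow> 'a::real_normed_vector \<Rightarrow> 'a) \<Rightarrow> bool" where
  "weak_Caratheodory I g \<longleftrightarrow>
     (\<forall>x. strongly_measurable (lebesgue_on I) (\<lambda>t. g t x)) \<and>
     (AE t in lebesgue_on I. seq_weakly_continuous (g t))"

text \<open>\<open>x\<^sup>r\<close> for real \<open>x \<ge> 0\<close>, \<open>r \<ge> 0\<close>, with \<open>0\<^sup>0 = 1\<close>; note that \<open>0 powr 0 = 0\<close>.\<close>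

definition real_pow :: "real \<Rightarrow> real \<Rightarrow> real" where
  "real_pow x r = (if r = 0 then 1 else x powr r)"

text \<open>Being a solution includes the Bochner integrability of the integrand.\<close>

definition integral_eq_solution ::
  "real \<Rightarrow> ('a::real_normed_vector \<Rightarrow> 'a) \<Rightarrow> (real \<Rightarrow> 'a \<Rightarrow> 'a) \<Rightarrow> (real \<Rightarrow> 'a) \<Rightarrow> bool" where
  "integral_eq_solution T f g u \<longleftrightarrow>
     (\<forall>t\<in>{0..T}. \<exists>J. has_strong_bochner_integral (lebesgue_on {0..t}) (\<lambda>s. g s (u s)) J \<and>
        u t = f (u t) + J)"

end

theory Submission
  imports Defs "HOL-Library.Diagonal_Subsequence"
begin

text \<open>By the derivative condition \<open>I - f\<close> is a bijection with a \<open>1\<close>-Lipschitz, everywhere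
  differentiable inverse \<open>k\<close>, and reflexivity makes \<open>k\<close> sequentially weakly continuous on bounded
  sequences. With \<open>v = u - f(u)\<close> the equation becomes \<open>v(t) = \<integral>\<^sub>0\<^sup>t g(s, k(v(s))) ds\<close>. Euler polygons
  for it stay in a fixed ball and are equi-Lipschitz up to the step size, so a diagonal subsequence
  converges weakly at every time; weak continuity of \<open>g(s, k(\<cdot>))\<close> and dominated convergence for each
  functional identify the limit as a solution. Strong measurability of the limiting integrand is
  Pettis' argument. Conversely, for any Lipschitz solution, \<open>v\<close> is an indefinite Bochner integral,
  hence almost everywhere differentiable, and so is \<open>u = k \<circ> v\<close>.\<close>

section \<open>Hahn-Banach and weak convergence\<close>

text \<open>The obstacle in inverting I - f is that the derivative condition is infinitesimal and
  bounds I - Df from below, whereas a mean value inequality only gives upper bounds. It therefore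
  has to be applied to an inverse already known to exist on the whole space; this is why I - \<mu> f
  with \<mu> < 1, invertible by contraction, comes before I - f. So vector identities and estimates
  are read off from functionals, of which Hahn-Banach supplies enough, and strong measurability of
  the limit is recovered inside a separable closed subspace. Step functions serve as approximations
  because measurability of g(t, x) for each fixed x makes g(t, w(t)) measurable for them at once.
  The speed bound is C (\<rho>^r + 1), with \<rho> so large that k maps the ball in which v moves
  into the ball of radius \<rho>.\<close>

definition sublinear :: "('a::real_vector \<Rightarrow> real) \<Rightarrow> bool" where
  "sublinear p \<longleftrightarrow> (\<forall>x y. p (x + y) \<le> p x + p y) \<and> (\<forall>c x. c > 0 \<longrightarrow> p (c *\<^sub>R x) \<le> c * p x)"

lemma sublinear_add: "sublinear p \<Longrightarrow> p (x + y) \<le> p x + p y"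
  by (simp add: sublinear_def)

text \<open>Applying the defining inequality to \<open>inverse c\<close> and
  \<open>c *\<^sub>R x\<close> reverses it. This is why \<open>sublinear\<close> asks for one
  inequality and positive factors only, which is all that has to be checked for the functionals
  constructed below.\<close>

lemma sublinear_scale:
  assumes "sublinear p" "c > 0"
  shows "p (c *\<^sub>R x) = c * p x"
proof (rule antisym)
  show "p (c *\<^sub>R x) \<le> c * p x" using assms by (simp add: sublinear_def)
  have "p (inverse c *\<^sub>R (c *\<^sub>R x)) \<le> inverse c * p (c *\<^sub>R x)"
    using assms unfolding sublinear_def by (meson positive_imp_inverse_positive)
  with assms show "c * p x \<le> p (c *\<^sub>R x)" by (simp add: field_simps)
qed

lemma sublinear_0: "sublinear p \<Longrightarrow> p 0 = 0"
  using sublinear_scale[of p 2 0] by simp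

lemma sublinear_neg: "sublinear p \<Longrightarrow> - p (- x) \<le> p x"
  using sublinear_add[of p x "- x"] sublinear_0[of p] by simp

lemma sublinear_shift_bound:
  assumes "sublinear p" "t \<ge> 0"
  shows "- p (- y) \<le> p (y + t *\<^sub>R x) - t * p x"
proof -
  have "p (t *\<^sub>R x) = t * p x"
    using assms sublinear_scale[of p t x] sublinear_0[of p] by (cases "t = 0") auto
  moreover have "p (t *\<^sub>R x) \<le> p (y + t *\<^sub>R x) + p (- y)"
    using sublinear_add[OF assms(1), of "y + t *\<^sub>R x" "- y"] by simp
  ultimately show ?thesis by simp
qed

text \<open>The infimum over t \<ge> 0 of p(y + t x) - t p(x) is taken; t = 0 and t = 1 give the two
  bounds. The second one is used twice: if p is minimal it says p(y) + p(x) \<le> p(y + x), hence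
  additivity; at y = -x it reads q(-x) \<le> -p(x), so a linear functional below q takes the value
  p(x) at x.\<close>

lemma sublinear_below_at_point:
  fixes p :: "'a::real_vector \<Rightarrow> real"
  assumes p: "sublinear p"
  obtains q where "sublinear q" "\<And>y. q y \<le> p y" "\<And>y. q y \<le> p (y + x) - p x"
proof -
  define F where "F y t = p (y + t *\<^sub>R x) - t * p x" for y t
  define q where "q y = (INF t\<in>{0..}. F y t)" for y
  have bdd: "bdd_below (F y ` {0..})" for y
    using sublinear_shift_bound[OF p] unfolding F_def by (intro bdd_belowI2[of _ "- p (- y)"]) auto
  have qle: "q y \<le> F y t" if "t \<ge> 0" for y t
    unfolding q_def using that bdd by (intro cINF_lower) auto
  have qge: "z \<le> q y" if "\<And>t. t \<ge> 0 \<Longrightarrow> z \<le> F y t" for y z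
    unfolding q_def using that by (intro cINF_greatest) auto
  have "q (y + z) \<le> q y + q z" for y z
  proof -
    have "q (y + z) - F z s \<le> F y t" if "t \<ge> 0" "s \<ge> 0" for s t
    proof -
      have "q (y + z) \<le> F (y + z) (t + s)" using that by (intro qle) auto
      also have "\<dots> \<le> F y t + F z s"
        using sublinear_add[OF p, of "y + t *\<^sub>R x" "z + s *\<^sub>R x"]
        unfolding F_def by (simp add: algebra_simps)
      finally show ?thesis by simp
    qed
    then have "q (y + z) - F z s \<le> q y" if "s \<ge> 0" for s using that by (intro qge) auto
    then have "q (y + z) - q y \<le> F z s" if "s \<ge> 0" for s using that by (simp add: algebra_simps)
    then have "q (y + z) - q y \<le> q z" by (intro qge)
    then show ?thesis by simp
  qed
  moreover have "q (c *\<^sub>R y) \<le> c * q y" if c: "c > 0" for c y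
  proof -
    have "q (c *\<^sub>R y) / c \<le> F y t" if "t \<ge> 0" for t
    proof -
      have "q (c *\<^sub>R y) \<le> F (c *\<^sub>R y) (c * t)" using c that by (intro qle) auto
      also have "\<dots> = c * F y t"
        using sublinear_scale[OF p c, of "y + t *\<^sub>R x"] unfolding F_def by (simp add: algebra_simps)
      finally show ?thesis using c by (simp add: field_simps)
    qed
    then have "q (c *\<^sub>R y) / c \<le> q y" by (intro qge)
    then show ?thesis using c by (simp add: field_simps)
  qed
  ultimately have "sublinear q" by (simp add: sublinear_def)
  moreover have "q y \<le> p y" for y using qle[of 0 y] by (simp add: F_def)
  moreover have "q y \<le> p (y + x) - p x" for y using qle[of 1 y] by (simp add: F_def)
  ultimately show ?thesis using that by blast
qed

text \<open>The pointwise infimum is finite because -p(-x) \<le> -q(-x) \<le> q(x) for each member.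
  Subadditivity uses the chain: two members q and q' have a common lower one s, and s(x + y) \<le>
  q(x) + q'(y).\<close>

lemma sublinear_chain_inf:
  fixes C :: "('a::real_vector \<Rightarrow> real) set"
  assumes sub: "\<And>q. q \<in> C \<Longrightarrow> sublinear q" "\<And>q x. q \<in> C \<Longrightarrow> q x \<le> p x"
    and chain: "\<And>q q'. q \<in> C \<Longrightarrow> q' \<in> C \<Longrightarrow> (\<forall>x. q x \<le> q' x) \<or> (\<forall>x. q' x \<le> q x)"
    and ne: "C \<noteq> {}"
  obtains m where "sublinear m" "\<And>q x. q \<in> C \<Longrightarrow> m x \<le> q x"
proof -
  define m where "m x = (INF q\<in>C. q x)" for x
  have bdd: "bdd_below ((\<lambda>q. q x) ` C)" for x
  proof (rule bdd_belowI2)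
    fix q assume "q \<in> C"
    then have "- p (- x) \<le> - q (- x)" "- q (- x) \<le> q x"
      using sublinear_neg[OF sub(1)] sub(2) by auto
    then show "- p (- x) \<le> q x" by simp
  qed
  have le: "m x \<le> q x" if "q \<in> C" for q x
    unfolding m_def using that bdd by (intro cINF_lower) auto
  have ge: "z \<le> m x" if "\<And>q. q \<in> C \<Longrightarrow> z \<le> q x" for x z
    unfolding m_def using that ne by (intro cINF_greatest) auto
  have "m (x + y) \<le> m x + m y" for x y
  proof -
    have "m (x + y) - q' y \<le> q x" if q: "q \<in> C" "q' \<in> C" for q q'
    proof -
      obtain s where s: "s \<in> C" "\<forall>x. s x \<le> q x \<and> s x \<le> q' x"
        using chain[OF q] q by (metis order_refl)
      have "m (x + y) \<le> s (x + y)" using s by (intro le)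
      also have "\<dots> \<le> s x + s y" using sub(1)[OF s(1)] by (rule sublinear_add)
      also have "\<dots> \<le> q x + q' y" using s by (meson add_mono)
      finally show ?thesis by simp
    qed
    then have "m (x + y) - q' y \<le> m x" if "q' \<in> C" for q' using that by (intro ge)
    then have "m (x + y) - m x \<le> q' y" if "q' \<in> C" for q' using that by fastforce
    then have "m (x + y) - m x \<le> m y" by (intro ge)
    then show ?thesis by simp
  qed
  moreover have "m (c *\<^sub>R x) \<le> c * m x" if c: "c > 0" for c x
  proof -
    have "m (c *\<^sub>R x) / c \<le> q x" if "q \<in> C" for q
      using le[OF that, of "c *\<^sub>R x"] sublinear_scale[OF sub(1)[OF that] c, of x] c
      by (simp add: field_simps)
    then have "m (c *\<^sub>R x) / c \<le> m x" by (intro ge)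
    then show ?thesis using c by (simp add: field_simps)
  qed
  ultimately show ?thesis using le that unfolding sublinear_def by blast
qed

text \<open>A minimal sublinear functional is linear, by \<open>sublinear_below_at_point\<close>.\<close>

lemma linear_below_sublinear:
  fixes p :: "'a::real_vector \<Rightarrow> real"
  assumes p: "sublinear p"
  obtains L where "linear L" "\<And>x. L x \<le> p x"
proof -
  define A where "A = {q. sublinear q \<and> (\<forall>x. q x \<le> p x)}"
  define P where "P q q' \<longleftrightarrow> (\<forall>x. q' x \<le> q x)" for q q' :: "'a \<Rightarrow> real"
  have "\<exists>m\<in>A. \<forall>a\<in>A. P m a \<longrightarrow> a = m"
  proof (rule predicate_Zorn)
    show "partial_order_on A (relation_of P A)"
      unfolding P_def by (rule partial_order_on_relation_ofI) (auto simp: fun_eq_iff intro: order_trans antisym)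
    fix C assume C: "C \<in> Chains (relation_of P A)"
    show "\<exists>u\<in>A. \<forall>a\<in>C. P a u"
    proof (cases "C = {}")
      case True
      with p show ?thesis by (auto simp: A_def intro!: exI[of _ p])
    next
      case False
      have CA: "C \<subseteq> A" using C by (auto simp: Chains_def relation_of_def)
      have ch: "P q q' \<or> P q' q" if "q \<in> C" "q' \<in> C" for q q'
        using C that by (auto simp: Chains_def relation_of_def)
      obtain m where m: "sublinear m" "\<And>q x. q \<in> C \<Longrightarrow> m x \<le> q x"
        using sublinear_chain_inf[of C p] CA ch False unfolding A_def P_def by blast
      obtain q where q: "q \<in> C" using False by auto
      have "m x \<le> p x" for x using m(2)[OF q, of x] q CA unfolding A_def by (blast intro: order_trans)
      then show ?thesis using m by (auto simp: A_def P_def)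
    qed
  qed
  then obtain L where L: "sublinear L" "\<And>x. L x \<le> p x"
    and min: "\<And>q. sublinear q \<Longrightarrow> (\<And>x. q x \<le> p x) \<Longrightarrow> (\<And>x. q x \<le> L x) \<Longrightarrow> q = L"
    by (auto simp: A_def P_def)
  have add: "L (y + x) = L y + L x" for x y
  proof -
    obtain q where q: "sublinear q" "\<And>y. q y \<le> L y" "\<And>y. q y \<le> L (y + x) - L x"
      using sublinear_below_at_point[OF L(1)] by blast
    have "q = L" using q L(2) by (intro min) (auto intro: order_trans)
    then show ?thesis using q(3)[of y] sublinear_add[OF L(1), of y x] by simp
  qed
  have neg: "L (- x) = - L x" for x
    using add[of x "- x"] sublinear_0[OF L(1)] by simp
  have "L (c *\<^sub>R x) = c * L x" for c x
  proof (cases c "0::real" rule: linorder_cases)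
    case less
    then have "L ((- c) *\<^sub>R x) = (- c) * L x" by (intro sublinear_scale[OF L(1)]) auto
    then show ?thesis by (simp add: neg)
  qed (simp_all add: sublinear_0[OF L(1)] sublinear_scale[OF L(1)])
  then have "linear L" using add by (intro linearI) auto
  then show ?thesis using L(2) that by blast
qed

theorem hahn_banach_point:
  fixes p :: "'a::real_vector \<Rightarrow> real"
  assumes p: "sublinear p"
  obtains L where "linear L" "\<And>y. L y \<le> p y" "L x = p x"
proof -
  obtain q where q: "sublinear q" "\<And>y. q y \<le> p y" "\<And>y. q y \<le> p (y + x) - p x"
    using sublinear_below_at_point[OF p] by blast
  obtain L where L: "linear L" "\<And>y. L y \<le> q y"
    using linear_below_sublinear[OF q(1)] by blast
  have "L (- x) \<le> - p x" using L(2)[of "- x"] q(3)[of "- x"] sublinear_0[OF p] by simp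
  then have "p x \<le> L x" using linear_neg[OF L(1), of x] by simp
  moreover have "L y \<le> p y" for y using L(2)[of y] q(2)[of y] by simp
  ultimately show ?thesis using L(1) by (intro that[of L]) (auto intro: antisym)
qed

lemma linear_bound_Blinfun:
  fixes L :: "'a::real_normed_vector \<Rightarrow> real"
  assumes "linear L" "\<And>y. L y \<le> K * norm y"
  obtains \<phi> :: "'a \<Rightarrow>\<^sub>L real" where "blinfun_apply \<phi> = L" "\<And>y. \<bar>\<phi> y\<bar> \<le> K * norm y"
proof -
  have b: "\<bar>L y\<bar> \<le> K * norm y" for y
    using assms(2)[of y] assms(2)[of "- y"] linear_neg[OF assms(1), of y] by auto
  have "bounded_linear L"
    using assms(1) b by (intro bounded_linear_intro[of L K])
      (auto simp: linear_add linear_scale mult.commute)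
  then have "blinfun_apply (Blinfun L) = L" by (rule bounded_linear_Blinfun_apply)
  with b that show ?thesis by metis
qed

text \<open>The distance to Y is itself sublinear, so it serves as the dominating functional. A
  linear functional below it vanishes on Y, since both y and -y have distance 0, and is bounded by
  the norm because 0 \<in> Y. The case Y = {0} yields norming functionals, a closed Y a membership
  test.\<close>

theorem hahn_banach_infdist:
  fixes Y :: "'a::real_normed_vector set"
  assumes Y: "subspace Y"
  obtains \<phi> :: "'a \<Rightarrow>\<^sub>L real"
    where "\<And>x. \<bar>\<phi> x\<bar> \<le> norm x" "\<And>y. y \<in> Y \<Longrightarrow> \<phi> y = 0" "\<phi> x = infdist x Y"
proof -
  have ne: "Y \<noteq> {}" using subspace_0[OF Y] by auto
  have near: "\<exists>y\<in>Y. dist x y < infdist x Y + e" if "e > 0" for x and e :: real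
  proof -
    have "Inf (dist x ` Y) < infdist x Y + e" using ne that by (simp add: infdist_def)
    then show ?thesis using ne by (subst (asm) cInf_less_iff) auto
  qed
  have "infdist (x + y) Y \<le> infdist x Y + infdist y Y" for x y
  proof (rule field_le_epsilon)
    fix e :: real assume "e > 0"
    then obtain a b where ab: "a \<in> Y" "dist x a < infdist x Y + e/2" "b \<in> Y" "dist y b < infdist y Y + e/2"
      using near[of "e/2"] by (meson half_gt_zero)
    have "infdist (x + y) Y \<le> dist (x + y) (a + b)"
      using ab Y by (intro infdist_le subspace_add)
    also have "\<dots> \<le> dist x a + dist y b" by (rule dist_triangle_add)
    finally show "infdist (x + y) Y \<le> infdist x Y + infdist y Y + e" using ab by simp
  qed
  moreover have "infdist (c *\<^sub>R x) Y \<le> c * infdist x Y" if c: "c > 0" for c x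
  proof (rule field_le_epsilon)
    fix e :: real assume "e > 0"
    then obtain a where a: "a \<in> Y" "dist x a < infdist x Y + e/c"
      using near[of "e/c"] c by (meson divide_pos_pos)
    have "infdist (c *\<^sub>R x) Y \<le> dist (c *\<^sub>R x) (c *\<^sub>R a)"
      using a Y by (intro infdist_le subspace_scale)
    also have "\<dots> = c * dist x a" using c by (simp add: dist_norm scaleR_right_diff_distrib[symmetric])
    also have "\<dots> \<le> c * (infdist x Y + e/c)" using a c by (intro mult_left_mono) auto
    finally show "infdist (c *\<^sub>R x) Y \<le> c * infdist x Y + e" using c by (simp add: algebra_simps)
  qed
  ultimately have "sublinear (\<lambda>x. infdist x Y)" by (simp add: sublinear_def)
  then obtain L where L: "linear L" "\<And>y. L y \<le> infdist y Y" "L x = infdist x Y"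
    using hahn_banach_point[of "\<lambda>x. infdist x Y" x] by blast
  have "infdist y Y \<le> 1 * norm y" for y
    using infdist_le[OF subspace_0[OF Y], of y] by (simp add: dist_norm)
  then obtain \<phi> :: "'a \<Rightarrow>\<^sub>L real" where \<phi>: "blinfun_apply \<phi> = L" "\<And>y. \<bar>\<phi> y\<bar> \<le> 1 * norm y"
    using linear_bound_Blinfun[OF L(1)] L(2) by (metis order_trans)
  have "\<phi> y = 0" if "y \<in> Y" for y
    using L(2)[of y] L(2)[of "- y"] that subspace_neg[OF Y that] linear_neg[OF L(1), of y]
    by (simp add: \<phi>(1))
  then show ?thesis using \<phi> L(3) by (intro that[of \<phi>]) auto
qed

lemma norming_functional:
  fixes x :: "'a::real_normed_vector"
  obtains \<phi> :: "'a \<Rightarrow>\<^sub>L real" where "\<And>y. \<bar>\<phi> y\<bar> \<le> norm y" "\<phi> x = norm x"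
proof (rule hahn_banach_infdist[of "{0::'a}" x])
  show "subspace {0::'a}" by (rule subspace_single_0)
  fix \<phi> :: "'a \<Rightarrow>\<^sub>L real"
  assume "\<And>y. \<bar>\<phi> y\<bar> \<le> norm y" "\<phi> x = infdist x {0}"
  then show ?thesis by (intro that[of \<phi>]) (auto simp: infdist_def)
qed

text \<open>Norm estimates for weak limits and Bochner integrals are obtained this way: a one-sided
  scalar bound for each functional dominated by the norm suffices, since one of them attains the
  norm of x.\<close>

lemma norm_le_functional:
  fixes x :: "'a::real_normed_vector"
  assumes "\<And>\<phi> :: 'a \<Rightarrow>\<^sub>L real. (\<And>y. \<bar>\<phi> y\<bar> \<le> norm y) \<Longrightarrow> \<phi> x \<le> B"
  shows "norm x \<le> B"
  using norming_functional[of x] assms by metis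

lemma functional_eqI:
  fixes x y :: "'a::real_normed_vector"
  assumes "\<And>\<phi> :: 'a \<Rightarrow>\<^sub>L real. \<phi> x = \<phi> y"
  shows "x = y"
  using norm_le_functional[of "x - y" 0] assms by (simp add: blinfun.diff_right)

lemma in_closed_subspaceI:
  fixes x :: "'a::real_normed_vector"
  assumes "subspace Y" "closed Y" "\<And>\<phi> :: 'a \<Rightarrow>\<^sub>L real. (\<And>y. y \<in> Y \<Longrightarrow> \<phi> y = 0) \<Longrightarrow> \<phi> x = 0"
  shows "x \<in> Y"
proof -
  obtain \<phi> :: "'a \<Rightarrow>\<^sub>L real" where \<phi>: "\<And>y. y \<in> Y \<Longrightarrow> \<phi> y = 0" "\<phi> x = infdist x Y"
    using hahn_banach_infdist[OF assms(1)] by metis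
  then have "infdist x Y = 0" using assms(3)[of \<phi>] by simp
  then show ?thesis using assms subspace_0 in_closed_iff_infdist_zero by blast
qed

section \<open>Weak convergence of sequences\<close>

lemma weakly_tendstoD:
  fixes \<phi> :: "'a::real_normed_vector \<Rightarrow>\<^sub>L real"
  shows "weakly_tendsto xs x \<Longrightarrow> (\<lambda>n. \<phi> (xs n)) \<longlonglongrightarrow> \<phi> x"
  by (simp add: weakly_tendsto_def)

lemma weakly_tendsto_unique:
  assumes "weakly_tendsto xs x" "weakly_tendsto xs y"
  shows "x = y"
proof (rule functional_eqI)
  fix \<phi> :: "'a \<Rightarrow>\<^sub>L real"
  show "\<phi> x = \<phi> y" using assms[THEN weakly_tendstoD] by (rule LIMSEQ_unique)
qed

lemma weakly_tendsto_subseq: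
  assumes "weakly_tendsto xs x" "strict_mono r"
  shows "weakly_tendsto (xs \<circ> r) x"
  unfolding weakly_tendsto_def
proof
  fix \<phi> :: "'a \<Rightarrow>\<^sub>L real"
  show "(\<lambda>n. \<phi> ((xs \<circ> r) n)) \<longlonglongrightarrow> \<phi> x"
    using LIMSEQ_subseq_LIMSEQ[OF weakly_tendstoD[OF assms(1)] assms(2)] by (simp add: o_def)
qed

lemma weakly_tendsto_diff:
  assumes "weakly_tendsto xs x" "weakly_tendsto ys y"
  shows "weakly_tendsto (\<lambda>n. xs n - ys n) (x - y)"
  unfolding weakly_tendsto_def blinfun.diff_right
  by (intro allI tendsto_diff assms[THEN weakly_tendstoD])

lemma weakly_tendsto_norm_bound:
  assumes "weakly_tendsto xs x" "\<And>n. norm (xs n) \<le> B"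
  shows "norm x \<le> B"
proof (rule norm_le_functional)
  fix \<phi> :: "'a \<Rightarrow>\<^sub>L real"
  assume b: "\<And>y. \<bar>\<phi> y\<bar> \<le> norm y"
  have "(\<lambda>n. \<phi> (xs n)) \<longlonglongrightarrow> \<phi> x" using assms by (simp add: weakly_tendsto_def)
  moreover have "\<phi> (xs n) \<le> B" for n using b[of "xs n"] assms(2)[of n] by linarith
  ultimately show "\<phi> x \<le> B" by (simp add: Lim_bounded)
qed

section \<open>Separable subspaces and countable norming families\<close>

lemma span_countable_separable:
  fixes X :: "'a::real_normed_vector set"
  assumes "countable X"
  obtains D where "countable D" "0 \<in> D" "D \<subseteq> span X" "span X \<subseteq> closure D"
proof -
  \<comment> \<open>Rational combinations are coded by lists of coefficient-vector pairs, so that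
    countability comes from that of lists.\<close>
  define F where "F = (\<lambda>l :: (rat \<times> 'a) list. sum_list (map (\<lambda>(q, x). of_rat q *\<^sub>R x) l))"
  define D where "D = F ` lists (UNIV \<times> X)"
  have F_simps: "F [] = 0" "F ((q, x) # l) = of_rat q *\<^sub>R x + F l" for q x l
    by (auto simp: F_def)
  have "countable D" unfolding D_def using assms by (intro countable_image countable_lists) auto
  moreover have D0: "0 \<in> D" unfolding D_def by (rule image_eqI[of _ _ "[]"]) (auto simp: F_simps)
  moreover have "F l \<in> span X" if "l \<in> lists (UNIV \<times> X)" for l
    using that
  proof (induction l)
    case (Cons a l)
    then show ?case by (cases a) (auto simp: F_simps intro!: span_add[OF span_scale[OF span_base]])
  qed (simp add: F_simps span_zero)
  then have "D \<subseteq> span X" by (auto simp: D_def)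
  moreover have "span X \<subseteq> closure D"
  proof
    fix y assume "y \<in> span X"
    then show "y \<in> closure D"
    proof (induction rule: span_induct_alt)
      case base
      then show ?case using D0 closure_subset by auto
    next
      case (step c x y)
      show ?case
      proof (unfold closure_approachable, intro allI impI)
        fix e :: real assume e: "e > 0"
        define d where "d = e / (2 * (norm x + 1))"
        have d: "d > 0" using e by (auto simp: d_def intro!: divide_pos_pos add_nonneg_pos)
        have dx: "d * norm x < e/2"
        proof -
          have "d * norm x < d * (norm x + 1)" using d by simp
          also have "\<dots> = e/2" by (simp add: d_def field_simps add_nonneg_eq_0_iff)
          finally show ?thesis .
        qed
        obtain q where q: "c < of_rat q" "of_rat q < c + d"
          using of_rat_dense[of c "c + d"] d by auto
        obtain z where z: "z \<in> D" "dist z y < e/2"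
          using step.IH e unfolding closure_approachable by (meson half_gt_zero)
        then obtain l where l: "l \<in> lists (UNIV \<times> X)" "z = F l" by (auto simp: D_def)
        have "of_rat q *\<^sub>R x + z \<in> D"
          unfolding D_def using l step.hyps
          by (intro image_eqI[of _ _ "(q, x) # l"]) (auto simp: F_simps)
        moreover have "dist (of_rat q *\<^sub>R x + z) (c *\<^sub>R x + y) < e"
        proof -
          have "dist (of_rat q *\<^sub>R x + z) (c *\<^sub>R x + y) \<le> dist (of_rat q *\<^sub>R x) (c *\<^sub>R x) + dist z y"
            by (rule dist_triangle_add)
          also have "dist (of_rat q *\<^sub>R x) (c *\<^sub>R x) = (of_rat q - c) * norm x"
            using q by (simp add: dist_norm scaleR_left_diff_distrib[symmetric])
          also have "\<dots> \<le> d * norm x" using q by (intro mult_right_mono) auto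
          finally show ?thesis using dx z by simp
        qed
        ultimately show "\<exists>u\<in>D. dist u (c *\<^sub>R x + y) < e" by blast
      qed
    qed
  qed
  ultimately show ?thesis using that by blast
qed

text \<open>A norming functional is picked at each d \<in> D. Functionals dominated by the norm are
  1-Lipschitz, so at a point y closer than e/2 to d the one chosen for d misses the norm of y by
  less than e. Membership of 0 makes D nonempty, so that it can be enumerated.\<close>

lemma countable_norming_family:
  fixes D :: "'a::real_normed_vector set"
  assumes "countable D" "0 \<in> D"
  obtains \<Phi> :: "nat \<Rightarrow> 'a \<Rightarrow>\<^sub>L real"
  where "\<And>k y. \<bar>\<Phi> k y\<bar> \<le> norm y"
    "\<And>y e. y \<in> closure D \<Longrightarrow> e > 0 \<Longrightarrow> \<exists>k. norm y - e < \<Phi> k y"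
proof -
  have "\<forall>d::'a. \<exists>\<phi> :: 'a \<Rightarrow>\<^sub>L real. (\<forall>y. \<bar>\<phi> y\<bar> \<le> norm y) \<and> \<phi> d = norm d"
    using norming_functional by metis
  then obtain \<psi> :: "'a \<Rightarrow> 'a \<Rightarrow>\<^sub>L real"
    where \<psi>: "\<And>d y. \<bar>\<psi> d y\<bar> \<le> norm y" "\<And>d. \<psi> d d = norm d" by metis
  define \<Phi> where "\<Phi> k = \<psi> (from_nat_into D k)" for k
  have "\<exists>k. norm y - e < \<Phi> k y" if y: "y \<in> closure D" and e: "e > 0" for y e
  proof -
    obtain d where d: "d \<in> D" "dist d y < e/2"
      using y e unfolding closure_approachable by (meson half_gt_zero)
    obtain k where k: "from_nat_into D k = d" using assms d(1) by (metis from_nat_into_surj)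
    have "norm d - \<psi> d y = \<psi> d (d - y)" by (simp add: \<psi> blinfun.diff_right)
    also have "\<dots> \<le> norm (d - y)" using \<psi>(1)[of d "d - y"] by linarith
    finally have "norm d - \<psi> d y < e/2" using d by (simp add: dist_norm)
    moreover have "norm y \<le> norm d + norm (d - y)" by (metis norm_triangle_sub norm_minus_commute)
    ultimately show ?thesis using d k by (auto simp: \<Phi>_def dist_norm intro!: exI[of _ k])
  qed
  then show ?thesis using that \<psi>(1) unfolding \<Phi>_def by blast
qed

section \<open>Weak sequential compactness in reflexive spaces\<close>

lemma reflexive_representer:
  fixes \<Psi> :: "('a::real_normed_vector \<Rightarrow>\<^sub>L real) \<Rightarrow> real"
  assumes "reflexive_space TYPE('a)" "linear \<Psi>" "\<And>\<phi>. \<Psi> \<phi> \<le> K * norm \<phi>"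
  obtains x :: 'a where "\<And>\<phi>. \<Psi> \<phi> = blinfun_apply \<phi> x"
proof -
  obtain \<Phi> :: "('a \<Rightarrow>\<^sub>L real) \<Rightarrow>\<^sub>L real" where "blinfun_apply \<Phi> = \<Psi>"
    using linear_bound_Blinfun[OF assms(2,3)] by metis
  then show ?thesis using assms(1) that unfolding reflexive_space_def by metis
qed

lemma functional_le_norm:
  fixes \<phi> :: "'a::real_normed_vector \<Rightarrow>\<^sub>L real"
  assumes "norm x \<le> B"
  shows "\<bar>\<phi> x\<bar> \<le> B * norm \<phi>"
proof -
  have "\<bar>\<phi> x\<bar> \<le> norm \<phi> * norm x" using norm_blinfun[of \<phi> x] by simp
  also have "\<dots> \<le> norm \<phi> * B" using assms by (intro mult_left_mono) auto
  finally show ?thesis by (simp add: mult.commute)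
qed

text \<open>Represent a linear functional below
  \<open>\<phi> \<mapsto> limsup (\<phi> (xs n))\<close> on the dual.\<close>

lemma weak_cluster_point:
  fixes xs :: "nat \<Rightarrow> 'a::real_normed_vector"
  assumes refl: "reflexive_space TYPE('a)" and B: "\<And>n. norm (xs n) \<le> B"
  obtains x :: 'a where
    "\<And>(\<phi> :: 'a \<Rightarrow>\<^sub>L real) c. eventually (\<lambda>n. \<phi> (xs n) \<le> c) sequentially \<Longrightarrow> \<phi> x \<le> c"
proof -
  define S where "S \<phi> = {c. eventually (\<lambda>n. blinfun_apply \<phi> (xs n) \<le> c) sequentially}"
    for \<phi> :: "'a \<Rightarrow>\<^sub>L real"
  define p where "p \<phi> = Inf (S \<phi>)" for \<phi>
  have b: "\<bar>\<phi> (xs n)\<bar> \<le> B * norm \<phi>" for \<phi> :: "'a \<Rightarrow>\<^sub>L real" and n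
    by (rule functional_le_norm[OF B])
  have low: "- (B * norm \<phi>) \<le> c" if c: "c \<in> S \<phi>" for c \<phi>
  proof -
    obtain n where "blinfun_apply \<phi> (xs n) \<le> c"
      using eventually_happens'[OF sequentially_bot] c unfolding S_def by blast
    with b[of \<phi> n] show ?thesis by simp
  qed
  have ne: "B * norm \<phi> \<in> S \<phi>" for \<phi>
    unfolding S_def using b[of \<phi>] by (auto intro!: always_eventually simp: abs_le_iff)
  have bdd: "bdd_below (S \<phi>)" for \<phi> using low by (intro bdd_belowI)
  have ple: "p \<phi> \<le> c" if "c \<in> S \<phi>" for c \<phi>
    unfolding p_def using that bdd by (rule cInf_lower)
  have near: "\<exists>c\<in>S \<phi>. c < p \<phi> + e" if "e > 0" for \<phi> e
    using cInf_less_iff[of "S \<phi>" "p \<phi> + e"] ne bdd that unfolding p_def by auto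
  have "p (\<phi> + \<psi>) \<le> p \<phi> + p \<psi>" for \<phi> \<psi>
  proof (rule field_le_epsilon)
    fix e :: real assume "e > 0"
    then obtain c d where cd: "c \<in> S \<phi>" "c < p \<phi> + e/2" "d \<in> S \<psi>" "d < p \<psi> + e/2"
      using near[of "e/2"] by (meson half_gt_zero)
    have "eventually (\<lambda>n. blinfun_apply (\<phi> + \<psi>) (xs n) \<le> c + d) sequentially"
      using cd(1,3) unfolding S_def mem_Collect_eq
      by eventually_elim (simp add: blinfun.add_left)
    then have "p (\<phi> + \<psi>) \<le> c + d" by (intro ple) (simp add: S_def)
    then show "p (\<phi> + \<psi>) \<le> p \<phi> + p \<psi> + e" using cd by simp
  qed
  moreover have "p (k *\<^sub>R \<phi>) \<le> k * p \<phi>" if k: "k > 0" for k \<phi>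
  proof (rule field_le_epsilon)
    fix e :: real assume "e > 0"
    then obtain c where c: "c \<in> S \<phi>" "c < p \<phi> + e/k" using near[of "e/k"] k by (meson divide_pos_pos)
    have "eventually (\<lambda>n. blinfun_apply (k *\<^sub>R \<phi>) (xs n) \<le> k * c) sequentially"
      using c(1) unfolding S_def mem_Collect_eq
      by eventually_elim (use k in \<open>simp add: blinfun.scaleR_left\<close>)
    then have "p (k *\<^sub>R \<phi>) \<le> k * c" by (intro ple) (simp add: S_def)
    also have "\<dots> \<le> k * (p \<phi> + e/k)" using c k by (intro mult_left_mono) auto
    finally show "p (k *\<^sub>R \<phi>) \<le> k * p \<phi> + e" using k by (simp add: algebra_simps)
  qed
  ultimately have "sublinear p" by (simp add: sublinear_def)
  then obtain \<Psi> where \<Psi>: "linear \<Psi>" "\<And>\<phi>. \<Psi> \<phi> \<le> p \<phi>" using linear_below_sublinear by blast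
  have "\<Psi> \<phi> \<le> B * norm \<phi>" for \<phi> using \<Psi>(2) ple[OF ne] by (rule order_trans)
  then obtain x where x: "\<And>\<phi>. \<Psi> \<phi> = blinfun_apply \<phi> x"
    using reflexive_representer[OF refl \<Psi>(1)] by blast
  show ?thesis
  proof (rule that)
    fix \<phi> :: "'a \<Rightarrow>\<^sub>L real" and c
    assume "eventually (\<lambda>n. \<phi> (xs n) \<le> c) sequentially"
    then have "p \<phi> \<le> c" by (intro ple) (simp add: S_def)
    with \<Psi>(2)[of \<phi>] show "\<phi> x \<le> c" by (simp add: x)
  qed
qed

text \<open>The diagonal sequence is known to satisfy the k-th property only after its first k + 1
  terms are dropped; \<open>tail\<close> carries the property back to the whole sequence.\<close>

lemma diagonal_subseq:
  assumes ex: "\<And>k s. strict_mono (s :: nat \<Rightarrow> nat) \<Longrightarrow> \<exists>r. strict_mono r \<and> Q k (s \<circ> r)"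
    and stable: "\<And>k s r. strict_mono (r :: nat \<Rightarrow> nat) \<Longrightarrow> Q k s \<Longrightarrow> Q k (s \<circ> r)"
    and tail: "\<And>k s. Q k (s \<circ> (+) (Suc k)) \<Longrightarrow> Q k s"
  obtains r :: "nat \<Rightarrow> nat" where "strict_mono r" "\<And>k. Q k r"
proof -
  interpret subseqs Q by (unfold_locales) (rule ex)
  show ?thesis using subseq_diagseq tail diagseq_holds[OF stable] by (intro that[of diagseq]) auto
qed

lemma subspace_closure:
  fixes S :: "'a::real_normed_vector set"
  assumes "subspace S"
  shows "subspace (closure S)"
proof (rule subspaceI)
  show "0 \<in> closure S" using assms subspace_0 closure_subset by blast
next
  fix x y assume "x \<in> closure S" "y \<in> closure S"
  then obtain a b where "\<And>n. a n \<in> S" "a \<longlonglongrightarrow> x" "\<And>n. b n \<in> S" "b \<longlonglongrightarrow> y"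
    unfolding closure_sequential by blast
  then show "x + y \<in> closure S"
    unfolding closure_sequential using assms
    by (intro exI[of _ "\<lambda>n. a n + b n"]) (auto intro: subspace_add tendsto_add)
next
  fix c :: real and x assume "x \<in> closure S"
  then obtain a where "\<And>n. a n \<in> S" "a \<longlonglongrightarrow> x" unfolding closure_sequential by blast
  then show "c *\<^sub>R x \<in> closure S"
    unfolding closure_sequential using assms
    by (intro exI[of _ "\<lambda>n. c *\<^sub>R a n"]) (auto intro: subspace_scale tendsto_scaleR)
qed

text \<open>The dual need not be separable, so one cannot diagonalise over all functionals. Only a
  countable norming family for the closed span Y of the sequence is made to converge. By reflexivity
  every subsequence has a cluster point; it lies in Y, and its values under the family are the
  limits already fixed. A norming family separates the points of Y, so all cluster points coincide,
  which forces weak convergence.\<close>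

theorem reflexive_weak_subseq:
  fixes xs :: "nat \<Rightarrow> 'a::real_normed_vector"
  assumes refl: "reflexive_space TYPE('a)" and B: "\<And>n. norm (xs n) \<le> B"
  obtains r x where "strict_mono r" "weakly_tendsto (xs \<circ> r) x"
proof -
  define Y where "Y = closure (span (range xs))"
  have Y: "subspace Y" "closed Y" unfolding Y_def by (simp_all add: subspace_closure)
  have xsY: "xs n \<in> Y" for n
    unfolding Y_def by (intro subsetD[OF closure_subset] span_base rangeI)
  obtain D where D: "countable D" "0 \<in> D" "span (range xs) \<subseteq> closure D"
    by (rule span_countable_separable[of "range xs"]) simp_all
  then have YD: "Y \<subseteq> closure D" unfolding Y_def by (simp add: closure_minimal)
  obtain \<Phi> :: "nat \<Rightarrow> 'a \<Rightarrow>\<^sub>L real"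
    where \<Phi>: "\<And>y e. y \<in> closure D \<Longrightarrow> e > 0 \<Longrightarrow> \<exists>k. norm y - e < \<Phi> k y"
    using countable_norming_family[OF D(1,2)] by metis
  obtain r :: "nat \<Rightarrow> nat" where r: "strict_mono r" "\<And>k. convergent (\<lambda>n. \<Phi> k (xs (r n)))"
  proof (rule diagonal_subseq[of "\<lambda>k s. convergent (\<lambda>n. \<Phi> k (xs (s n)))"])
    fix k and s :: "nat \<Rightarrow> nat"
    have "\<bar>\<Phi> k (xs (s n))\<bar> \<le> B * norm (\<Phi> k)" for n by (rule functional_le_norm[OF B])
    then have "bounded (range (\<lambda>n. \<Phi> k (xs (s n))))" by (intro boundedI) auto
    then show "\<exists>r. strict_mono r \<and> convergent (\<lambda>n. \<Phi> k (xs ((s \<circ> r) n)))"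
      using bounded_imp_convergent_subsequence[of "\<lambda>n. \<Phi> k (xs (s n))"]
      by (auto simp: convergent_def o_def)
  next
    fix k and s r :: "nat \<Rightarrow> nat"
    assume "strict_mono r" "convergent (\<lambda>n. \<Phi> k (xs (s n)))"
    then show "convergent (\<lambda>n. \<Phi> k (xs ((s \<circ> r) n)))"
      using convergent_subseq_convergent[of "\<lambda>n. \<Phi> k (xs (s n))" r] by (simp add: o_def)
  next
    fix k and s :: "nat \<Rightarrow> nat"
    assume "convergent (\<lambda>n. \<Phi> k (xs ((s \<circ> (+) (Suc k)) n)))"
    then show "convergent (\<lambda>n. \<Phi> k (xs (s n)))"
      using convergent_ignore_initial_segment[of "\<lambda>n. \<Phi> k (xs (s n))" "Suc k"]
      by (simp add: o_def add.commute)
  qed blast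
  have cluster: "\<exists>x\<in>Y. (\<forall>k. (\<lambda>n. \<Phi> k (xs (r n))) \<longlonglongrightarrow> \<Phi> k x) \<and>
      (\<forall>(\<phi> :: 'a \<Rightarrow>\<^sub>L real) c. eventually (\<lambda>n. \<phi> (xs (r (s n))) \<le> c) sequentially \<longrightarrow> \<phi> x \<le> c)"
    if s: "strict_mono s" for s :: "nat \<Rightarrow> nat"
  proof -
    obtain x where x: "\<And>(\<phi> :: 'a \<Rightarrow>\<^sub>L real) c.
        eventually (\<lambda>n. \<phi> (xs (r (s n))) \<le> c) sequentially \<Longrightarrow> \<phi> x \<le> c"
      using weak_cluster_point[OF refl, of "\<lambda>n. xs (r (s n))" B] B by blast
    \<comment> \<open>The one-sided cluster property, applied to \<phi> and to -\<phi>, turns a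
      limit along the subsequence into the exact value at the cluster point.\<close>
    have lim: "\<phi> x = l" if "(\<lambda>n. \<phi> (xs (r (s n)))) \<longlonglongrightarrow> l" for \<phi> :: "'a \<Rightarrow>\<^sub>L real" and l
    proof (rule antisym)
      have le: "\<psi> x \<le> m" if m: "(\<lambda>n. \<psi> (xs (r (s n)))) \<longlonglongrightarrow> m" for \<psi> :: "'a \<Rightarrow>\<^sub>L real" and m
      proof (rule field_le_epsilon)
        fix e :: real assume "e > 0"
        then have "eventually (\<lambda>n. \<psi> (xs (r (s n))) < m + e) sequentially"
          using order_tendstoD(2)[OF m, of "m + e"] by simp
        then have "eventually (\<lambda>n. \<psi> (xs (r (s n))) \<le> m + e) sequentially"
          by (rule eventually_mono) simp
        then show "\<psi> x \<le> m + e" by (rule x)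
      qed
      show "\<phi> x \<le> l" using that by (rule le)
      have "(- \<phi>) x \<le> - l"
        using tendsto_minus[OF that] by (intro le) (simp add: blinfun.minus_left)
      then show "l \<le> \<phi> x" by (simp add: blinfun.minus_left)
    qed
    have "x \<in> Y"
    proof (rule in_closed_subspaceI[OF Y])
      fix \<phi> :: "'a \<Rightarrow>\<^sub>L real" assume "\<And>y. y \<in> Y \<Longrightarrow> \<phi> y = 0"
      then have "\<phi> (xs (r (s n))) = 0" for n using xsY by blast
      then show "\<phi> x = 0" by (intro lim) simp
    qed
    moreover have "(\<lambda>n. \<Phi> k (xs (r n))) \<longlonglongrightarrow> \<Phi> k x" for k
    proof -
      obtain l where l: "(\<lambda>n. \<Phi> k (xs (r n))) \<longlonglongrightarrow> l" using r(2)[of k] by (auto simp: convergent_def)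
      then have "(\<lambda>n. \<Phi> k (xs (r (s n)))) \<longlonglongrightarrow> l"
        using LIMSEQ_subseq_LIMSEQ[OF l s] by (simp add: o_def)
      with l lim show ?thesis by simp
    qed
    ultimately show ?thesis using x by blast
  qed
  have unique: "x = y" if "x \<in> Y" "y \<in> Y"
    "\<And>k. (\<lambda>n. \<Phi> k (xs (r n))) \<longlonglongrightarrow> \<Phi> k x" "\<And>k. (\<lambda>n. \<Phi> k (xs (r n))) \<longlonglongrightarrow> \<Phi> k y" for x y
  proof -
    have eq: "\<Phi> k (x - y) = 0" for k
      using LIMSEQ_unique[OF that(3,4)] by (simp add: blinfun.diff_right)
    have "norm (x - y) \<le> 0 + e" if "e > 0" for e
    proof -
      have "x - y \<in> closure D" using \<open>x \<in> Y\<close> \<open>y \<in> Y\<close> Y(1) YD subspace_diff by blast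
      with \<Phi>[OF this \<open>e > 0\<close>] eq show ?thesis by auto
    qed
    then have "norm (x - y) \<le> 0" by (rule field_le_epsilon)
    then show ?thesis by simp
  qed
  obtain x where x: "x \<in> Y" "\<And>k. (\<lambda>n. \<Phi> k (xs (r n))) \<longlonglongrightarrow> \<Phi> k x"
    using cluster[of id] strict_mono_id by auto
  \<comment> \<open>A subsequence on which \<phi> stays at least \<phi>(x) + e has a cluster point
    of its own; this point keeps the gap, yet by uniqueness it equals x.\<close>
  have upper: "eventually (\<lambda>n. \<phi> (xs (r n)) < \<phi> x + e) sequentially"
    if "e > 0" for \<phi> :: "'a \<Rightarrow>\<^sub>L real" and e
  proof (rule ccontr)
    assume "\<not> ?thesis"
    then obtain s :: "nat \<Rightarrow> nat" where s: "strict_mono s" "\<And>n. \<not> \<phi> (xs (r (s n))) < \<phi> x + e"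
      using not_eventually_sequentiallyD by metis
    obtain x' where x': "x' \<in> Y" "\<And>k. (\<lambda>n. \<Phi> k (xs (r n))) \<longlonglongrightarrow> \<Phi> k x'"
      and le: "\<And>(\<phi> :: 'a \<Rightarrow>\<^sub>L real) c. eventually (\<lambda>n. \<phi> (xs (r (s n))) \<le> c) sequentially \<Longrightarrow> \<phi> x' \<le> c"
      using cluster[OF s(1)] by blast
    have "x' = x" using x x' by (intro unique)
    have "(- \<phi>) (xs (r (s n))) \<le> - (\<phi> x + e)" for n using s(2)[of n] by (simp add: blinfun.minus_left)
    then have "(- \<phi>) x' \<le> - (\<phi> x + e)" by (intro le) simp
    with \<open>x' = x\<close> \<open>e > 0\<close> show False by (simp add: blinfun.minus_left)
  qed
  have "weakly_tendsto (xs \<circ> r) x"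
    unfolding weakly_tendsto_def
  proof (intro allI order_tendstoI)
    fix \<phi> :: "'a \<Rightarrow>\<^sub>L real" and a
    assume "\<phi> x < a"
    then show "eventually (\<lambda>n. \<phi> ((xs \<circ> r) n) < a) sequentially"
      using upper[of "a - \<phi> x" \<phi>] by simp
  next
    fix \<phi> :: "'a \<Rightarrow>\<^sub>L real" and a
    assume "a < \<phi> x"
    then show "eventually (\<lambda>n. a < \<phi> ((xs \<circ> r) n)) sequentially"
      using upper[of "\<phi> x - a" "- \<phi>"] by (simp add: blinfun.minus_left)
  qed
  with r(1) show ?thesis by (rule that)
qed

text \<open>If some functional stayed away from its expected limit along a subsequence, a further
  subsequence would converge weakly by reflexivity, and \<open>sub\<close> identifies its limit as
  x.\<close>

lemma weakly_tendsto_by_subseq: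
  fixes xs :: "nat \<Rightarrow> 'a::real_normed_vector"
  assumes refl: "reflexive_space TYPE('a)" and B: "\<And>n. norm (xs n) \<le> B"
    and sub: "\<And>r z. strict_mono r \<Longrightarrow> weakly_tendsto (xs \<circ> r) z \<Longrightarrow> z = x"
  shows "weakly_tendsto xs x"
  unfolding weakly_tendsto_def
proof (intro allI tendstoI)
  fix \<phi> :: "'a \<Rightarrow>\<^sub>L real" and e :: real
  assume e: "e > 0"
  show "eventually (\<lambda>n. dist (\<phi> (xs n)) (\<phi> x) < e) sequentially"
  proof (rule ccontr)
    assume "\<not> ?thesis"
    then obtain s :: "nat \<Rightarrow> nat" where s: "strict_mono s" "\<And>n. \<not> dist (\<phi> (xs (s n))) (\<phi> x) < e"
      using not_eventually_sequentiallyD by metis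
    obtain r z where r: "strict_mono r" "weakly_tendsto ((xs \<circ> s) \<circ> r) z"
      using reflexive_weak_subseq[OF refl, of "xs \<circ> s" B] B by auto
    then have "weakly_tendsto ((xs \<circ> s) \<circ> r) x"
      using sub[of "s \<circ> r" z] strict_mono_o[OF s(1) r(1)] by (simp add: o_assoc)
    then have "(\<lambda>n. \<phi> (xs (s (r n)))) \<longlonglongrightarrow> \<phi> x" by (auto dest: weakly_tendstoD simp: o_def)
    from tendstoD[OF this e] obtain n where "dist (\<phi> (xs (s (r n)))) (\<phi> x) < e"
      using eventually_happens'[OF sequentially_bot] by blast
    with s(2) show False by blast
  qed
qed

text \<open>The weak limit along a single subsequence already identifies the limits of all the
  convergent scalar sequences.\<close>

lemma weakly_convergentI:
  fixes xs :: "nat \<Rightarrow> 'a::real_normed_vector"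
  assumes refl: "reflexive_space TYPE('a)" and B: "\<And>n. norm (xs n) \<le> B"
    and conv: "\<And>\<phi> :: 'a \<Rightarrow>\<^sub>L real. convergent (\<lambda>n. \<phi> (xs n))"
  obtains x where "weakly_tendsto xs x"
proof -
  obtain r x where r: "strict_mono r" "weakly_tendsto (xs \<circ> r) x"
    by (rule reflexive_weak_subseq[OF refl, of xs B]) (use B in auto)
  have "weakly_tendsto xs x"
    unfolding weakly_tendsto_def
  proof
    fix \<phi> :: "'a \<Rightarrow>\<^sub>L real"
    obtain l where l: "(\<lambda>n. \<phi> (xs n)) \<longlonglongrightarrow> l" using conv[of \<phi>] by (auto simp: convergent_def)
    have "(\<lambda>n. \<phi> (xs (r n))) \<longlonglongrightarrow> l"
      using LIMSEQ_subseq_LIMSEQ[OF l r(1)] by (simp add: o_def)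
    moreover have "(\<lambda>n. \<phi> (xs (r n))) \<longlonglongrightarrow> \<phi> x"
      using weakly_tendstoD[OF r(2)] by (simp add: o_def)
    ultimately show "(\<lambda>n. \<phi> (xs n)) \<longlonglongrightarrow> \<phi> x" using l LIMSEQ_unique by blast
  qed
  then show ?thesis by (rule that)
qed

section \<open>Inverting the identity minus a nonexpansive map\<close>

lemma contraction_perturbation_surj:
  fixes F :: "'a::banach \<Rightarrow> 'a"
  assumes "1-lipschitz_on UNIV F" "0 \<le> \<mu>" "\<mu> < 1"
  obtains x where "x - \<mu> *\<^sub>R F x = y"
proof -
  have "\<exists>!x. y + \<mu> *\<^sub>R F x = x"
  proof (rule banach_fix_type[OF assms(2,3)], intro allI)
    fix a b
    have "dist (F a) (F b) \<le> dist a b" using lipschitz_onD[OF assms(1), of a b] by simp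
    then show "dist (y + \<mu> *\<^sub>R F a) (y + \<mu> *\<^sub>R F b) \<le> \<mu> * dist a b"
      using assms(2) by (simp add: dist_norm scaleR_right_diff_distrib[symmetric] mult_left_mono)
  qed
  then obtain x where "y + \<mu> *\<^sub>R F x = x" by blast
  then show ?thesis by (intro that[of x]) (simp add: algebra_simps)
qed

text \<open>Write a - b as (a - \<mu> b) - (1 - \<mu>) b and use that b is no longer than a. Applied
  both to increments of a map and to its derivative, this trades a lower bound for I - F with
  constant 1 for one for I - \<mu> F with constant \<mu>.\<close>

lemma norm_scaled_diff_ge:
  fixes a b :: "'a::real_normed_vector"
  assumes "norm b \<le> norm a" "norm a \<le> norm (a - b)" "0 \<le> \<mu>" "\<mu> \<le> 1"
  shows "\<mu> * norm a \<le> norm (a - \<mu> *\<^sub>R b)"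
proof -
  have "norm (a - b) = norm ((a - \<mu> *\<^sub>R b) - (1 - \<mu>) *\<^sub>R b)" by (simp add: algebra_simps)
  also have "\<dots> \<le> norm (a - \<mu> *\<^sub>R b) + (1 - \<mu>) * norm b"
    using norm_triangle_ineq4[of "a - \<mu> *\<^sub>R b" "(1 - \<mu>) *\<^sub>R b"] assms by simp
  also have "(1 - \<mu>) * norm b \<le> (1 - \<mu>) * norm a" using assms by (intro mult_left_mono) auto
  finally have "norm (a - b) \<le> norm (a - \<mu> *\<^sub>R b) + (1 - \<mu>) * norm a" by simp
  then show ?thesis using assms(2) by (simp add: algebra_simps)
qed

text \<open>Write \<open>I - F = (I - 3/4 F) - 1/4 F\<close>: the first summand is inverted by a contraction
  argument, its inverse is \<open>4/3\<close>-Lipschitz, and the rest is again a contraction.\<close>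

lemma nonexpansive_expansive_surj:
  fixes F :: "'a::banach \<Rightarrow> 'a"
  assumes lip: "1-lipschitz_on UNIV F"
    and exp: "\<And>x y. norm (x - y) \<le> norm ((x - F x) - (y - F y))"
  obtains x where "x - F x = y"
proof -
  \<comment> \<open>The inverse of I - \<mu> F is 1/\<mu>-Lipschitz, and the remaining part of F has
    Lipschitz constant 1 - \<mu>, so the second fixed point map contracts by (1 - \<mu>)/\<mu>. Any
    \<mu> strictly between 1/2 and 1 would do; 3/4 gives the factor 1/3.\<close>
  define H where "H x = x - (3/4) *\<^sub>R F x" for x
  have "\<exists>x. H x = z" for z
    unfolding H_def using contraction_perturbation_surj[OF lip, of "3/4" z] by auto
  then obtain k where k: "\<And>z. H (k z) = z" by metis
  have ge: "(3/4) * norm (a - b) \<le> norm (H a - H b)" for a b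
  proof -
    have "(3/4) * norm (a - b) \<le> norm ((a - b) - (3/4) *\<^sub>R (F a - F b))"
      using exp[of a b] lipschitz_onD[OF lip, of a b]
      by (intro norm_scaled_diff_ge) (auto simp: dist_norm algebra_simps)
    then show ?thesis by (simp add: H_def algebra_simps)
  qed
  have kl: "norm (k a - k b) \<le> (4/3) * norm (a - b)" for a b
    using ge[of "k a" "k b"] by (simp add: k)
  have "\<exists>!x. k (y + (1/4) *\<^sub>R F x) = x"
  proof (rule banach_fix_type[of "1/3"], simp, simp, intro allI)
    fix a b
    have "norm (k (y + (1/4) *\<^sub>R F a) - k (y + (1/4) *\<^sub>R F b)) \<le> (4/3) * norm ((1/4) *\<^sub>R (F a - F b))"
      using kl[of "y + (1/4) *\<^sub>R F a" "y + (1/4) *\<^sub>R F b"] by (simp add: algebra_simps)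
    also have "\<dots> = (1/3) * norm (F a - F b)" by simp
    also have "\<dots> \<le> (1/3) * norm (a - b)"
      using lipschitz_onD[OF lip, of a b] by (simp add: dist_norm)
    finally show "dist (k (y + (1/4) *\<^sub>R F a)) (k (y + (1/4) *\<^sub>R F b)) \<le> 1/3 * dist a b"
      by (simp add: dist_norm)
  qed
  then obtain x where x: "k (y + (1/4) *\<^sub>R F x) = x" by blast
  have "H x = y + (1/4) *\<^sub>R F x" using k[of "y + (1/4) *\<^sub>R F x"] x by simp
  then have "x - F x = y"
    using scaleR_left_distrib[of "3/4" "1/4" "F x"] by (simp add: H_def algebra_simps)
  then show ?thesis by (rule that)
qed

section \<open>Global lower bounds from lower bounds on the derivative\<close>

lemma lipschitz_derivative_norm_le:
  fixes f :: "'a::real_normed_vector \<Rightarrow> 'b::real_normed_vector"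
  assumes lip: "1-lipschitz_on UNIV f" and der: "(f has_derivative A) (at u)"
  shows "norm (A w) \<le> norm w"
proof (cases "w = 0")
  case True
  then show ?thesis using der by (simp add: linear_0 has_derivative_linear)
next
  case False
  interpret A: bounded_linear A using der by (rule has_derivative_bounded_linear)
  show ?thesis
  proof (rule field_le_epsilon)
    fix e :: real assume e: "e > 0"
    define e' where "e' = e / norm w"
    have "e' > 0" using e False by (simp add: e'_def)
    then obtain d where d: "d > 0"
      "\<And>x. norm (x - u) < d \<Longrightarrow> norm (f x - f u - A (x - u)) \<le> e' * norm (x - u)"
      using der unfolding has_derivative_at_alt by meson
    \<comment> \<open>The increment t w has half the length d up to which the linear approximation
      is valid; homogeneity of A then removes t.\<close>
    define t where "t = d / (2 * norm w)"
    have t: "t > 0" using d False by (simp add: t_def)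
    have "norm (t *\<^sub>R w) < d" using d False by (simp add: t_def)
    then have "norm (f (u + t *\<^sub>R w) - f u - A (t *\<^sub>R w)) \<le> e' * norm (t *\<^sub>R w)"
      using d(2)[of "u + t *\<^sub>R w"] by simp
    moreover have "norm (f (u + t *\<^sub>R w) - f u) \<le> norm (t *\<^sub>R w)"
      using lipschitz_onD[OF lip, of "u + t *\<^sub>R w" u] by (simp add: dist_norm)
    ultimately have "norm (A (t *\<^sub>R w)) \<le> norm (t *\<^sub>R w) + e' * norm (t *\<^sub>R w)"
      using norm_triangle_ineq4[of "f (u + t *\<^sub>R w) - f u" "f (u + t *\<^sub>R w) - f u - A (t *\<^sub>R w)"] by simp
    then have "t * norm (A w) \<le> t * (norm w + e' * norm w)"
      using t by (simp add: A.scaleR algebra_simps)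
    then have "norm (A w) \<le> norm w + e' * norm w" using t by simp
    then show "norm (A w) \<le> norm w + e" using False by (simp add: e'_def)
  qed
qed

text \<open>Differentiability is given at a single point, so there is no continuous derivative for
  the inverse function theorem; instead k is known beforehand and continuous. The lower bound makes
  H injective with bounded inverse, without the open mapping theorem, and bounds the norm of the
  derivative of k.\<close>

lemma inverse_has_derivative_bound:
  fixes h :: "'a::real_normed_vector \<Rightarrow> 'a"
  assumes hk: "\<And>y. h (k y) = y" and cont: "isCont k y"
    and der: "(h has_derivative H) (at (k y))"
    and surj: "surj H" and c: "c > 0" and low: "\<And>w. c * norm w \<le> norm (H w)"
  obtains K where "(k has_derivative K) (at y)" "onorm K \<le> 1 / c"
proof -
  interpret H: bounded_linear H using der by (rule has_derivative_bounded_linear)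
  have "inj H"
  proof (rule injI)
    fix a b assume "H a = H b"
    then have "c * norm (a - b) \<le> 0" using low[of "a - b"] by (simp add: H.diff)
    then show "a = b" using c by (simp add: mult_le_0_iff)
  qed
  define K where "K = inv H"
  have HK: "H (K z) = z" for z using surj by (simp add: K_def surj_f_inv_f)
  have KH: "K (H z) = z" for z using \<open>inj H\<close> by (simp add: K_def)
  have bound: "norm (K z) \<le> 1 / c * norm z" for z
    using low[of "K z"] c by (simp add: HK field_simps)
  have "bounded_linear K"
  proof (rule bounded_linear_intro)
    show "K (a + b) = K a + K b" for a b
    proof -
      have "H (K (a + b)) = H (K a + K b)" by (simp only: H.add HK)
      then show ?thesis using \<open>inj H\<close> by (simp add: inj_eq)
    qed
    show "K (r *\<^sub>R a) = r *\<^sub>R K a" for r a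
    proof -
      have "H (K (r *\<^sub>R a)) = H (r *\<^sub>R K a)" by (simp only: H.scaleR HK)
      then show ?thesis using \<open>inj H\<close> by (simp add: inj_eq)
    qed
    show "norm (K z) \<le> norm z * (1 / c)" for z using bound[of z] by (simp add: mult.commute)
  qed
  then have "(k has_derivative K) (at y)"
    using cont hk KH
    by (intro has_derivative_inverse_basic[where f = h and g = k and y = y and T = UNIV and f' = H and g' = K])
      (auto simp: fun_eq_iff der)
  moreover have "onorm K \<le> 1 / c" using bound c by (intro onorm_bound) auto
  ultimately show ?thesis by (rule that)
qed

text \<open>For \<open>\<mu> < 1\<close> the map \<open>I - \<mu> f\<close> is a homeomorphism with Lipschitz inverse, whose derivative
  has norm at most \<open>1 / \<mu>\<close>; the mean value inequality gives the claim up to \<open>\<mu>\<close>.\<close>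

lemma nonexpansive_derivative_expansive:
  fixes f :: "'a::banach \<Rightarrow> 'a"
  assumes lip: "1-lipschitz_on UNIV f"
    and der: "\<And>u. (f has_derivative A u) (at u)"
    and low: "\<And>u w. norm w \<le> norm (w - A u w)"
  shows "norm (x - y) \<le> norm ((x - f x) - (y - f y))"
proof -
  have lip': "norm (f a - f b) \<le> norm (a - b)" for a b
    using lipschitz_onD[OF lip, of a b] by (simp add: dist_norm)
  have Ale: "norm (A u w) \<le> norm w" for u w by (rule lipschitz_derivative_norm_le[OF lip der])
  have Alin: "linear (A u)" for u using der has_derivative_linear by blast
  have Alip: "1-lipschitz_on UNIV (A u)" for u
  proof (rule lipschitz_onI)
    show "dist (A u a) (A u b) \<le> 1 * dist a b" for a b
      using Ale[of u "a - b"] linear_diff[OF Alin[of u], of a b] by (simp add: dist_norm)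
  qed simp
  have main: "\<mu> * norm (x - y) \<le> norm ((x - y) - \<mu> *\<^sub>R (f x - f y))" if \<mu>: "0 < \<mu>" "\<mu> < 1" for \<mu>
  proof -
    define h where "h u = u - \<mu> *\<^sub>R f u" for u
    have "\<exists>u. h u = z" for z
      unfolding h_def using contraction_perturbation_surj[OF lip, of \<mu> z] \<mu> by auto
    then obtain k where hk: "\<And>z. h (k z) = z" by metis
    have hge: "(1 - \<mu>) * norm (a - b) \<le> norm (h a - h b)" for a b
    proof -
      have "norm (a - b) - \<mu> * norm (f a - f b) \<le> norm ((a - b) - \<mu> *\<^sub>R (f a - f b))"
        using norm_triangle_ineq2[of "a - b" "\<mu> *\<^sub>R (f a - f b)"] \<mu> by simp
      moreover have "\<mu> * norm (f a - f b) \<le> \<mu> * norm (a - b)"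
        using \<mu> lip' by (intro mult_left_mono) auto
      ultimately show ?thesis by (simp add: h_def algebra_simps)
    qed
    have kh: "k (h a) = a" for a
      using hge[of "k (h a)" a] \<mu> by (simp add: hk mult_le_0_iff)
    \<comment> \<open>This constant blows up as \<mu> tends to 1 and serves only to make k
      continuous; the useful constant 1/\<mu> comes from the derivative of k.\<close>
    have "(1 / (1 - \<mu>))-lipschitz_on UNIV k"
    proof (rule lipschitz_onI)
      show "dist (k a) (k b) \<le> 1 / (1 - \<mu>) * dist a b" for a b
        using hge[of "k a" "k b"] \<mu> by (simp add: hk dist_norm field_simps)
    qed (use \<mu> in simp)
    then have cont: "isCont k z" for z
      using lipschitz_on_continuous_on continuous_on_eq_continuous_at by blast
    have "\<exists>K. (k has_derivative K) (at z) \<and> onorm K \<le> 1 / \<mu>" for z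
    proof -
      have 1: "(h has_derivative (\<lambda>w. w - \<mu> *\<^sub>R A (k z) w)) (at (k z))"
        unfolding h_def by (intro derivative_intros der)
      have 2: "surj (\<lambda>w. w - \<mu> *\<^sub>R A (k z) w)"
        unfolding surj_def using contraction_perturbation_surj[OF Alip[of "k z"], of \<mu>] \<mu>
        by (metis less_imp_le)
      have 3: "\<mu> * norm w \<le> norm (w - \<mu> *\<^sub>R A (k z) w)" for w
        using Ale low \<mu> by (intro norm_scaled_diff_ge) auto
      show ?thesis
        using inverse_has_derivative_bound[where h = h and k = k, OF hk cont 1 2 \<mu>(1) 3] by blast
    qed
    then obtain K where K: "\<And>z. (k has_derivative K z) (at z)" "\<And>z. onorm (K z) \<le> 1 / \<mu>" by metis
    have "norm (k (h x) - k (h y)) \<le> 1 / \<mu> * norm (h x - h y)"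
      using K by (intro differentiable_bound[of UNIV k K]) auto
    then have "\<mu> * norm (x - y) \<le> norm (h x - h y)" using \<mu> by (simp add: kh field_simps)
    then show ?thesis by (simp add: h_def algebra_simps)
  qed
  show ?thesis
  proof (rule field_le_mult_one_interval)
    fix z :: real assume z: "0 < z" "z < 1"
    \<comment> \<open>Replacing I - \<mu> f by I - f costs 1 - \<mu> times the distance of x and y,
      on top of the factor \<mu> in \<open>main\<close>; what remains is 2 \<mu> - 1, which is
      z.\<close>
    define \<mu> where "\<mu> = (1 + z) / 2"
    have \<mu>: "0 < \<mu>" "\<mu> < 1" "z = 2 * \<mu> - 1" using z by (auto simp: \<mu>_def field_simps)
    have eq: "(x - y) - \<mu> *\<^sub>R (f x - f y) = ((x - f x) - (y - f y)) + (1 - \<mu>) *\<^sub>R (f x - f y)"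
      by (simp add: algebra_simps)
    have "norm ((x - y) - \<mu> *\<^sub>R (f x - f y)) \<le> norm ((x - f x) - (y - f y)) + (1 - \<mu>) * norm (f x - f y)"
      unfolding eq using norm_triangle_ineq[of "(x - f x) - (y - f y)" "(1 - \<mu>) *\<^sub>R (f x - f y)"] \<mu> by simp
    moreover have "(1 - \<mu>) * norm (f x - f y) \<le> (1 - \<mu>) * norm (x - y)"
      using lip' \<mu> by (intro mult_left_mono) auto
    ultimately show "z * norm (x - y) \<le> norm ((x - f x) - (y - f y))"
      using main[OF \<mu>(1,2)] unfolding \<mu>(3) left_diff_distrib by linarith
  qed
qed

text \<open>The lower bound for I - f makes k unique and 1-Lipschitz. For weak continuity, the bound
  B keeps the images bounded, so weakly convergent subsequences can be examined: if k(y_n) tends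
  weakly to z, weak continuity of f makes y_n = k(y_n) - f(k(y_n)) tend weakly to z - f(z), hence z
  = k(y).\<close>

lemma resolvent:
  fixes f :: "'a::banach \<Rightarrow> 'a"
  assumes refl: "reflexive_space TYPE('a)"
    and weak: "seq_weakly_continuous f"
    and lip: "1-lipschitz_on UNIV f"
    and der: "\<And>u. (f has_derivative A u) (at u)"
    and low: "\<And>u w. norm w \<le> norm (w - A u w)"
  obtains k where "\<And>y. k y - f (k y) = y" "\<And>u. k (u - f u) = u"
    "1-lipschitz_on UNIV k" "\<And>y. k differentiable (at y)"
    "\<And>ys y B. weakly_tendsto ys y \<Longrightarrow> (\<And>n. norm (ys n) \<le> B) \<Longrightarrow> weakly_tendsto (\<lambda>n. k (ys n)) (k y)"
proof -
  have exp: "norm (x - y) \<le> norm ((x - f x) - (y - f y))" for x y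
    by (rule nonexpansive_derivative_expansive[OF lip der low])
  have "\<exists>x. x - f x = y" for y using nonexpansive_expansive_surj[OF lip exp, of y] by blast
  then obtain k where k: "\<And>y. k y - f (k y) = y" by metis
  have kh: "k (u - f u) = u" for u using exp[of "k (u - f u)" u] by (simp add: k)
  have kl: "norm (k a - k b) \<le> norm (a - b)" for a b using exp[of "k a" "k b"] by (simp add: k)
  then have klip: "1-lipschitz_on UNIV k" by (intro lipschitz_onI) (auto simp: dist_norm)
  have cont: "isCont k z" for z
    using klip lipschitz_on_continuous_on continuous_on_eq_continuous_at by blast
  have diff: "k differentiable (at y)" for y
  proof -
    have Alin: "linear (A u)" for u using der has_derivative_linear by blast
    have Alip: "1-lipschitz_on UNIV (A (k y))"
    proof (rule lipschitz_onI)
      show "dist (A (k y) a) (A (k y) b) \<le> 1 * dist a b" for a b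
        using lipschitz_derivative_norm_le[OF lip der, of "k y" "a - b"] linear_diff[OF Alin, of "k y" a b]
        by (simp add: dist_norm)
    qed simp
    have "\<exists>w. w - A (k y) w = z" for z
    proof (rule nonexpansive_expansive_surj[OF Alip])
      show "norm (a - b) \<le> norm (a - A (k y) a - (b - A (k y) b))" for a b
        using low[of "a - b" "k y"] linear_diff[OF Alin, of "k y" a b] by (simp add: algebra_simps)
    qed blast
    then have 2: "surj (\<lambda>w. w - A (k y) w)" unfolding surj_def by metis
    have 1: "((\<lambda>u. u - f u) has_derivative (\<lambda>w. w - A (k y) w)) (at (k y))"
      by (intro derivative_intros der)
    have 3: "1 * norm w \<le> norm (w - A (k y) w)" for w using low by simp
    obtain K where "(k has_derivative K) (at y)"
      using inverse_has_derivative_bound[where h = "\<lambda>u. u - f u" and k = k,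
          OF k cont 1 2 zero_less_one 3] by blast
    then show ?thesis by (auto simp: differentiable_def)
  qed
  have "weakly_tendsto (\<lambda>n. k (ys n)) (k y)"
    if ys: "weakly_tendsto ys y" and B: "\<And>n. norm (ys n) \<le> B" for ys y B
  proof (rule weakly_tendsto_by_subseq[OF refl])
    show "norm (k (ys n)) \<le> B + norm (k 0)" for n
      using kl[of "ys n" 0] B[of n] norm_triangle_sub[of "k (ys n)" "k 0"] by simp
  next
    fix r :: "nat \<Rightarrow> nat" and z
    assume r: "strict_mono r" and z: "weakly_tendsto ((\<lambda>n. k (ys n)) \<circ> r) z"
    have "weakly_tendsto (\<lambda>n. f (k (ys (r n)))) (f z)"
      using weak z unfolding seq_weakly_continuous_def by (auto simp: o_def)
    with z have "weakly_tendsto (\<lambda>n. k (ys (r n)) - f (k (ys (r n)))) (z - f z)"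
      by (intro weakly_tendsto_diff) (simp_all add: o_def)
    then have "weakly_tendsto (ys \<circ> r) (z - f z)" by (simp add: k o_def)
    then have "z - f z = y" using weakly_tendsto_subseq[OF ys r] weakly_tendsto_unique by blast
    then show "z = k y" using kh[of z] by simp
  qed
  then show ?thesis using k kh klip diff that by blast
qed

section \<open>Strong measurability and the Bochner integral\<close>

lemma (in complete_measure) borel_measurable_AE_eq:
  assumes "f \<in> borel_measurable M" "AE x in M. f x = g x"
  shows "g \<in> borel_measurable M"
proof (rule measurableI)
  fix S :: "'b set" assume "S \<in> sets borel"
  then have A: "f -` S \<inter> space M \<in> sets M" using assms(1) by (rule measurable_sets[rotated])
  have ae: "AE x in M. x \<in> f -` S \<inter> space M \<longleftrightarrow> x \<in> g -` S \<inter> space M"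
    using assms(2) by eventually_elim auto
  show "g -` S \<inter> space M \<in> sets M" by (rule in_sets_AE[OF ae A]) simp
qed simp

lemma (in complete_measure) borel_measurable_AE_LIMSEQ:
  fixes g :: "'a \<Rightarrow> real"
  assumes "\<And>n. f n \<in> borel_measurable M" "AE x in M. (\<lambda>n. f n x) \<longlonglongrightarrow> g x"
  shows "g \<in> borel_measurable M"
proof (rule borel_measurable_AE_eq)
  show "(\<lambda>x. lim (\<lambda>n. f n x)) \<in> borel_measurable M"
    using assms(1) by (rule borel_measurable_lim_metric)
  show "AE x in M. lim (\<lambda>n. f n x) = g x"
    using assms(2) by eventually_elim (rule limI)
qed

lemma complete_measure_lebesgue_on:
  assumes "S \<in> sets lebesgue"
  shows "complete_measure (lebesgue_on S)"
proof
  fix A B assume AB: "A \<subseteq> B" "B \<in> null_sets (lebesgue_on S)"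
  then have "B \<subseteq> S" "B \<in> null_sets lebesgue"
    using assms by (auto simp: null_sets_restrict_space)
  then have "A \<in> sets lebesgue" using AB completion.complete2 by blast
  then show "A \<in> sets (lebesgue_on S)"
    using AB \<open>B \<subseteq> S\<close> assms by (auto simp: sets_restrict_space_iff)
qed

text \<open>Composition with a real-valued continuous map leads back to Borel measurability. It
  serves for functionals and for distances to a fixed point; only simple functions are composed, so
  the codomain need not be second countable.\<close>

lemma (in complete_measure) strongly_measurable_isCont:
  fixes c :: "'b::real_normed_vector \<Rightarrow> real"
  assumes h: "strongly_measurable M h" and c: "\<And>x. isCont c x"
  shows "(\<lambda>t. c (h t)) \<in> borel_measurable M"
proof -
  obtain s where s: "\<And>n. simple_function M (s n)" "AE t in M. (\<lambda>n. s n t) \<longlonglongrightarrow> h t"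
    using h unfolding strongly_measurable_def by blast
  show ?thesis
  proof (rule borel_measurable_AE_LIMSEQ)
    show "(\<lambda>t. c (s n t)) \<in> borel_measurable M" for n
      by (rule borel_measurable_simple_function[OF simple_function_compose1[OF s(1)]])
    show "AE t in M. (\<lambda>n. c (s n t)) \<longlonglongrightarrow> c (h t)"
      using s(2) by eventually_elim (rule isCont_tendsto_compose[OF c])
  qed
qed

lemma (in complete_measure) strongly_measurable_norm_diff_simple:
  fixes h :: "'a \<Rightarrow> 'b::real_normed_vector"
  assumes h: "strongly_measurable M h" and f: "simple_function M f"
  shows "(\<lambda>t. norm (h t - f t)) \<in> borel_measurable M"
proof -
  obtain s where s: "\<And>n. simple_function M (s n)" "AE t in M. (\<lambda>n. s n t) \<longlonglongrightarrow> h t"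
    using h unfolding strongly_measurable_def by blast
  show ?thesis
  proof (rule borel_measurable_AE_LIMSEQ)
    show "(\<lambda>t. norm (s n t - f t)) \<in> borel_measurable M" for n
      by (rule borel_measurable_simple_function[OF simple_function_compose2[OF s(1) f]])
    show "AE t in M. (\<lambda>n. norm (s n t - f t)) \<longlonglongrightarrow> norm (h t - f t)"
      using s(2) by eventually_elim (intro tendsto_intros)
  qed
qed

lemma strongly_measurable_countable_range:
  fixes h :: "'b \<Rightarrow> 'a::real_normed_vector"
  assumes "strongly_measurable M h"
  obtains X where "countable X" "AE t in M. h t \<in> closure X"
proof -
  obtain s :: "nat \<Rightarrow> 'b \<Rightarrow> 'a" where s: "\<And>n. simple_function M (s n)" "AE t in M. (\<lambda>n. s n t) \<longlonglongrightarrow> h t"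
    using assms unfolding strongly_measurable_def by blast
  define X where "X = (\<Union>n. s n ` space M)"
  have "countable X"
    unfolding X_def using s(1) by (intro countable_UN) (auto simp: simple_function_def countable_finite)
  moreover have "AE t in M. h t \<in> closure X"
    using s(2) AE_space
  proof eventually_elim
    case (elim t)
    then show ?case
      unfolding closure_sequential X_def by (intro exI[of _ "\<lambda>n. s n t"]) auto
  qed
  ultimately show ?thesis by (rule that)
qed

text \<open>Approximate \<open>h t\<close> by the nearest among the first \<open>n + 1\<close> points of a dense sequence.\<close>

lemma strongly_measurable_separableI:
  fixes h :: "'b \<Rightarrow> 'a::real_normed_vector"
  assumes D: "countable D" "D \<noteq> {}"
    and meas: "\<And>d. d \<in> D \<Longrightarrow> (\<lambda>t. norm (h t - d)) \<in> borel_measurable M"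
    and range: "AE t in M. h t \<in> closure D"
  shows "strongly_measurable M h"
proof -
  define d where "d = from_nat_into D"
  have dD: "d k \<in> D" for k unfolding d_def using D by (simp add: from_nat_into)
  have [measurable]: "(\<lambda>t. norm (h t - d k)) \<in> borel_measurable M" for k using meas dD by blast
  \<comment> \<open>The index k marks a nearest point to h(t) among the first n + 1. Taking the
    least such index breaks ties measurably, and only finitely many indices occur.\<close>
  define P where "P n t k \<longleftrightarrow> k \<le> n \<and> (\<forall>j\<le>n. norm (h t - d k) \<le> norm (h t - d j))" for n t k
  define \<kappa> where "\<kappa> n t = (LEAST k. P n t k)" for n t
  have ex: "\<exists>k. P n t k" for n t
  proof -
    obtain k where "k \<in> {..n}" "\<And>j. j \<in> {..n} \<Longrightarrow> norm (h t - d k) \<le> norm (h t - d j)"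
      using ex_is_arg_min_if_finite[of "{..n}" "\<lambda>j. norm (h t - d j)"]
      by (auto simp: is_arg_min_linorder)
    then show ?thesis by (auto simp: P_def)
  qed
  have P\<kappa>: "P n t (\<kappa> n t)" for n t
    unfolding \<kappa>_def using ex by (rule LeastI_ex)
  have [measurable]: "Measurable.pred M (\<lambda>t. P n t k)" for n k
    unfolding P_def by measurable
  have [measurable]: "\<kappa> n \<in> measurable M (count_space UNIV)" for n
    unfolding \<kappa>_def by measurable
  have "simple_function M (\<kappa> n)" for n
  proof (subst simple_function_def, intro conjI ballI)
    have "\<kappa> n ` space M \<subseteq> {..n}" using P\<kappa> by (auto simp: P_def)
    then show "finite (\<kappa> n ` space M)" by (rule finite_subset) simp
    show "\<kappa> n -` {k} \<inter> space M \<in> sets M" for k by measurable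
  qed
  then have "simple_function M (\<lambda>t. d (\<kappa> n t))" for n by (rule simple_function_compose1)
  moreover have "AE t in M. (\<lambda>n. d (\<kappa> n t)) \<longlonglongrightarrow> h t"
    using range
  proof eventually_elim
    case (elim t)
    show ?case
    proof (rule LIMSEQ_I)
      fix e :: real assume "e > 0"
      then obtain y where y: "y \<in> D" "dist y (h t) < e"
        using elim unfolding closure_approachable by blast
      obtain k where "d k = y" unfolding d_def using y D by (metis from_nat_into_surj)
      then have k: "norm (h t - d k) < e" using y by (simp add: dist_norm norm_minus_commute)
      have "norm (d (\<kappa> n t) - h t) < e" if "n \<ge> k" for n
        using P\<kappa>[of n t] that k unfolding P_def by (metis norm_minus_commute order.strict_trans1)
      then show "\<exists>N. \<forall>n\<ge>N. norm (d (\<kappa> n t) - h t) < e" by blast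
    qed
  qed
  ultimately show ?thesis
    unfolding strongly_measurable_def by (intro exI[of _ "\<lambda>n t. d (\<kappa> n t)"] conjI allI)
qed

text \<open>Pettis: the weak limit has separable range, where the norm is a supremum of countably many
  functionals, so distances to fixed points are measurable.\<close>

theorem (in complete_measure) strongly_measurable_weak_limit:
  fixes h :: "'a \<Rightarrow> 'b::real_normed_vector"
  assumes hn: "\<And>n. strongly_measurable M (hs n)"
    and lim: "AE t in M. weakly_tendsto (\<lambda>n. hs n t) (h t)"
  shows "strongly_measurable M h"
proof -
  have "\<exists>X. countable X \<and> (AE t in M. hs n t \<in> closure X)" for n
    by (rule strongly_measurable_countable_range[OF hn[of n]]) blast
  then obtain X where X: "\<And>n. countable (X n)" "\<And>n. AE t in M. hs n t \<in> closure (X n)" by metis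
  \<comment> \<open>A weak limit may leave the norm closure of the ranges, but not their closed
    span: functionals vanishing on the span also vanish at the limit.\<close>
  define Y where "Y = closure (span (\<Union>n. X n))"
  have Y: "subspace Y" "closed Y" unfolding Y_def by (simp_all add: subspace_closure)
  have XY: "closure (X n) \<subseteq> Y" for n
    unfolding Y_def by (intro closure_mono) (auto intro: span_base)
  obtain D where D: "countable D" "0 \<in> D" "D \<subseteq> span (\<Union>n. X n)" "span (\<Union>n. X n) \<subseteq> closure D"
    by (rule span_countable_separable[of "\<Union>n. X n"]) (use X(1) in simp_all)
  have YD: "Y \<subseteq> closure D" unfolding Y_def using D(4) by (simp add: closure_minimal)
  have DY: "D \<subseteq> Y" unfolding Y_def using D(3) closure_subset by (rule order_trans)
  obtain \<Phi> :: "nat \<Rightarrow> 'b \<Rightarrow>\<^sub>L real"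
    where \<Phi>: "\<And>k y. \<bar>\<Phi> k y\<bar> \<le> norm y"
      "\<And>y e. y \<in> closure D \<Longrightarrow> e > 0 \<Longrightarrow> \<exists>k. norm y - e < \<Phi> k y"
    using countable_norming_family[OF D(1,2)] by metis
  have "AE t in M. \<forall>n. hs n t \<in> closure (X n)" using X(2) by (simp add: AE_all_countable)
  with lim have hY: "AE t in M. h t \<in> Y"
  proof eventually_elim
    case (elim t)
    show ?case
    proof (rule in_closed_subspaceI[OF Y])
      fix \<phi> :: "'b \<Rightarrow>\<^sub>L real" assume "\<And>y. y \<in> Y \<Longrightarrow> \<phi> y = 0"
      then have "\<phi> (hs n t) = 0" for n using elim(2) XY by blast
      then show "\<phi> (h t) = 0" using weakly_tendstoD[OF elim(1), of \<phi>] by (simp add: LIMSEQ_const_iff)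
    qed
  qed
  have \<Phi>meas: "(\<lambda>t. \<Phi> k (h t - d)) \<in> borel_measurable M" for k d
  proof (rule borel_measurable_AE_LIMSEQ)
    show "(\<lambda>t. \<Phi> k (hs n t - d)) \<in> borel_measurable M" for n
      using hn by (rule strongly_measurable_isCont) (intro continuous_intros)
    show "AE t in M. (\<lambda>n. \<Phi> k (hs n t - d)) \<longlonglongrightarrow> \<Phi> k (h t - d)"
      using lim by eventually_elim (auto simp: blinfun.diff_right intro: tendsto_diff weakly_tendstoD)
  qed
  have "(\<lambda>t. norm (h t - d)) \<in> borel_measurable M" if d: "d \<in> D" for d
  proof (rule borel_measurable_AE_LIMSEQ)
    \<comment> \<open>Maxima over finitely many functionals increase to the norm, because h(t) - d
      lies in the set on which the family is norming.\<close>
    show "(\<lambda>t. Max ((\<lambda>k. \<Phi> k (h t - d)) ` {..n})) \<in> borel_measurable M" for n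
      using \<Phi>meas by (intro borel_measurable_Max) auto
    show "AE t in M. (\<lambda>n. Max ((\<lambda>k. \<Phi> k (h t - d)) ` {..n})) \<longlonglongrightarrow> norm (h t - d)"
      using hY
    proof eventually_elim
      case (elim t)
      let ?m = "\<lambda>n. Max ((\<lambda>k. \<Phi> k (h t - d)) ` {..n})"
      have in_cl: "h t - d \<in> closure D" using elim d DY YD Y(1) subspace_diff by blast
      have le: "?m n \<le> norm (h t - d)" for n
        using \<Phi>(1) by (intro Max.boundedI) (auto simp: abs_le_iff)
      show ?case
      proof (rule LIMSEQ_I)
        fix e :: real assume "e > 0"
        then obtain k where k: "norm (h t - d) - e < \<Phi> k (h t - d)" using \<Phi>(2)[OF in_cl] by blast
        have "norm (?m n - norm (h t - d)) < e" if "n \<ge> k" for n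
        proof -
          have "\<Phi> k (h t - d) \<le> ?m n" using that by (intro Max_ge) auto
          with k le[of n] show ?thesis by simp
        qed
        then show "\<exists>N. \<forall>n\<ge>N. norm (?m n - norm (h t - d)) < e" by blast
      qed
    qed
  qed
  moreover have "AE t in M. h t \<in> closure D" using hY by eventually_elim (use YD in blast)
  ultimately show ?thesis using D(1,2) by (intro strongly_measurable_separableI[of D]) auto
qed

text \<open>Used along step functions of time: measurability for each frozen state suffices, because
  the simple approximations can be switched by \<kappa> together with the functions they
  approximate.\<close>

lemma strongly_measurable_piecewise:
  fixes \<kappa> :: "'b \<Rightarrow> nat"
  assumes h: "\<And>k. strongly_measurable M (h k)" and \<kappa>: "simple_function M \<kappa>"
  shows "strongly_measurable M (\<lambda>t. h (\<kappa> t) t)"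
proof -
  have "\<exists>s. (\<forall>n. simple_function M (s n)) \<and> (AE t in M. (\<lambda>n. s n t) \<longlonglongrightarrow> h k t)" for k
    using h[of k] unfolding strongly_measurable_def by blast
  then obtain s where s: "\<And>k n. simple_function M (s k n)" "\<And>k. AE t in M. (\<lambda>n. s k n t) \<longlonglongrightarrow> h k t"
    by metis
  have [measurable]: "\<kappa> \<in> measurable M (count_space UNIV)" using \<kappa> by (rule measurable_simple_function)
  have [measurable]: "s k n \<in> measurable M (count_space UNIV)" for k n
    using s(1) by (rule measurable_simple_function)
  have "simple_function M (\<lambda>t. s (\<kappa> t) n t)" for n
  proof (subst simple_function_def, intro conjI ballI)
    have "(\<lambda>t. s (\<kappa> t) n t) ` space M \<subseteq> (\<Union>k\<in>\<kappa> ` space M. s k n ` space M)" by auto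
    then show "finite ((\<lambda>t. s (\<kappa> t) n t) ` space M)"
      by (rule finite_subset) (intro finite_UN_I simple_functionD(1)[OF \<kappa>] simple_functionD(1)[OF s(1)])
    fix y
    have "(\<lambda>t. s (\<kappa> t) n t) -` {y} \<inter> space M = (\<Union>k. {t \<in> space M. \<kappa> t = k \<and> s k n t = y})" by auto
    also have "\<dots> \<in> sets M" by measurable
    finally show "(\<lambda>t. s (\<kappa> t) n t) -` {y} \<inter> space M \<in> sets M" .
  qed
  moreover have "AE t in M. \<forall>k. (\<lambda>n. s k n t) \<longlonglongrightarrow> h k t" using s(2) by (simp add: AE_all_countable)
  then have "AE t in M. (\<lambda>n. s (\<kappa> t) n t) \<longlonglongrightarrow> h (\<kappa> t) t" by eventually_elim blast
  ultimately show ?thesis unfolding strongly_measurable_def by (intro exI[of _ "\<lambda>n t. s (\<kappa> t) n t"]) auto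
qed

lemma strongly_measurable_subset:
  assumes h: "strongly_measurable (lebesgue_on S) h"
    and S: "S' \<subseteq> S" "S \<in> sets lebesgue" "S' \<in> sets lebesgue"
  shows "strongly_measurable (lebesgue_on S') h"
proof -
  obtain s where s: "\<And>n. simple_function (lebesgue_on S) (s n)"
      "AE t in lebesgue_on S. (\<lambda>n. s n t) \<longlonglongrightarrow> h t"
    using h unfolding strongly_measurable_def by blast
  have "simple_function (lebesgue_on S') (s n)" for n
  proof (subst simple_function_def, intro conjI ballI)
    have "finite (s n ` S)" using s(1)[of n] by (simp add: simple_function_def)
    then show "finite (s n ` space (lebesgue_on S'))"
      using S(1) by (auto intro: finite_subset[OF image_mono])
    fix y assume "y \<in> s n ` space (lebesgue_on S')"
    then have "s n -` {y} \<inter> S \<in> sets (lebesgue_on S)"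
      using s(1)[of n] S(1) by (auto simp: simple_function_def)
    then have "(s n -` {y} \<inter> S) \<inter> S' \<in> sets lebesgue" using S by (auto simp: sets_restrict_space_iff)
    moreover have "(s n -` {y} \<inter> S) \<inter> S' = s n -` {y} \<inter> S'" using S(1) by auto
    ultimately show "s n -` {y} \<inter> space (lebesgue_on S') \<in> sets (lebesgue_on S')"
      using S by (auto simp: sets_restrict_space_iff)
  qed
  moreover have "AE t in lebesgue_on S'. (\<lambda>n. s n t) \<longlonglongrightarrow> h t"
    using s(2) S by (auto simp: AE_restrict_space_iff)
  ultimately show ?thesis unfolding strongly_measurable_def by blast
qed

section \<open>Existence of the Bochner integral and its behaviour under functionals\<close>

lemma (in complete_measure) simple_bochner_integral_dist_le:
  fixes h :: "'a \<Rightarrow> 'b::real_normed_vector"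
  assumes h: "strongly_measurable M h"
    and s: "Bochner_Integration.simple_bochner_integrable M s"
    and t: "Bochner_Integration.simple_bochner_integrable M t"
  shows "ennreal (norm (Bochner_Integration.simple_bochner_integral M s - Bochner_Integration.simple_bochner_integral M t)) \<le>
    (\<integral>\<^sup>+ x. norm (h x - s x) \<partial>M) + (\<integral>\<^sup>+ x. norm (h x - t x) \<partial>M)"
    (is "ennreal (norm (?s - ?t)) \<le> ?S + ?T")
proof -
  have sf: "simple_function M s" "simple_function M t"
    using s t by (auto elim: simple_bochner_integrable.cases)
  have "ennreal (norm (?s - ?t)) = norm (Bochner_Integration.simple_bochner_integral M (\<lambda>x. s x - t x))"
    using s t by (subst simple_bochner_integral_diff) auto
  also have "\<dots> \<le> Bochner_Integration.simple_bochner_integral M (\<lambda>x. norm (s x - t x))"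
    using simple_bochner_integrable_compose2[of "(-)" M s t] s t
    by (auto intro!: simple_bochner_integral_norm_bound)
  also have "\<dots> = (\<integral>\<^sup>+x. norm (s x - t x) \<partial>M)"
    using simple_bochner_integrable_compose2[of "\<lambda>x y. norm (x - y)" M s t] s t
    by (auto intro!: simple_bochner_integral_eq_nn_integral)
  also have "\<dots> \<le> (\<integral>\<^sup>+x. ennreal (norm (h x - s x)) + ennreal (norm (h x - t x)) \<partial>M)"
  proof (rule nn_integral_mono)
    fix x
    have "norm (s x - t x) \<le> norm (h x - s x) + norm (h x - t x)"
      by (metis dual_order.refl norm_diff_triangle_le norm_minus_commute)
    then show "ennreal (norm (s x - t x)) \<le> ennreal (norm (h x - s x)) + ennreal (norm (h x - t x))"
      by (simp add: ennreal_leI flip: ennreal_plus)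
  qed
  also have "\<dots> = ?S + ?T"
    using strongly_measurable_norm_diff_simple[OF h] sf by (intro nn_integral_add) auto
  finally show ?thesis .
qed

theorem (in complete_measure) bounded_has_strong_bochner_integral:
  fixes h :: "'a \<Rightarrow> 'b::banach"
  assumes fin: "finite_measure M" and h: "strongly_measurable M h"
    and K: "\<And>t. t \<in> space M \<Longrightarrow> norm (h t) \<le> K"
  obtains J where "has_strong_bochner_integral M h J"
proof -
  interpret finite_measure M by fact
  obtain s where s: "\<And>n. simple_function M (s n)" "AE t in M. (\<lambda>n. s n t) \<longlonglongrightarrow> h t"
    using h unfolding strongly_measurable_def by blast
  \<comment> \<open>Since h is bounded by K, almost everywhere the approximations eventually have
    norm below K + 1, so truncation there does not affect the limit, while it bounds the error by 2
    K + 1.\<close>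
  define s' where "s' n t = (if norm (s n t) \<le> K + 1 then s n t else 0)" for n t
  have s'_simple: "simple_function M (s' n)" for n
    unfolding s'_def by (rule simple_function_compose1[OF s(1), where g = "\<lambda>y. if norm y \<le> K + 1 then y else 0"])
  have s'_int: "Bochner_Integration.simple_bochner_integrable M (s' n)" for n
    using s'_simple by (rule simple_bochner_integrable.intros) (simp add: emeasure_finite)
  have s'_lim: "AE t in M. (\<lambda>n. s' n t) \<longlonglongrightarrow> h t"
    using s(2) AE_space
  proof eventually_elim
    case (elim t)
    have "(\<lambda>n. norm (s n t)) \<longlonglongrightarrow> norm (h t)" using elim(1) by (rule tendsto_norm)
    then have "eventually (\<lambda>n. norm (s n t) < K + 1) sequentially"
      using K[OF elim(2)] by (intro order_tendstoD) auto
    then have "eventually (\<lambda>n. s n t = s' n t) sequentially"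
      by eventually_elim (simp add: s'_def)
    with elim(1) show ?case by (rule Lim_transform_eventually)
  qed
  \<comment> \<open>On an empty space K may be negative, so its sign is only recorded almost
    everywhere.\<close>
  have K0: "AE t in M. 0 \<le> K" using AE_space by eventually_elim (use K norm_ge_zero order_trans in blast)
  have lim0: "(\<lambda>n. \<integral>\<^sup>+t. ennreal (norm (h t - s' n t)) \<partial>M) \<longlonglongrightarrow> (\<integral>\<^sup>+t. 0 \<partial>M)"
  proof (rule nn_integral_dominated_convergence[where w = "\<lambda>_. ennreal (2 * K + 1)"])
    show "(\<lambda>t. ennreal (norm (h t - s' n t))) \<in> borel_measurable M" for n
      using strongly_measurable_norm_diff_simple[OF h s'_simple] by simp
    show "(\<integral>\<^sup>+t. ennreal (2 * K + 1) \<partial>M) < \<infinity>"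
      by (simp add: less_top[symmetric] ennreal_mult_eq_top_iff)
    show "AE t in M. ennreal (norm (h t - s' n t)) \<le> ennreal (2 * K + 1)" for n
      using AE_space K0
    proof eventually_elim
      case (elim t)
      have "norm (s' n t) \<le> K + 1" using elim by (simp add: s'_def)
      with K[OF elim(1)] norm_triangle_ineq4[of "h t" "s' n t"] show ?case by (intro ennreal_leI) linarith
    qed
    show "AE t in M. (\<lambda>n. ennreal (norm (h t - s' n t))) \<longlonglongrightarrow> 0"
      using s'_lim
    proof eventually_elim
      case (elim t)
      have "(\<lambda>n. norm (h t - s' n t)) \<longlonglongrightarrow> norm (h t - h t)" using elim by (intro tendsto_intros)
      then show ?case by (metis diff_self ennreal_0 norm_zero tendsto_ennrealI)
    qed
  qed auto
  let ?I = "\<lambda>n. Bochner_Integration.simple_bochner_integral M (s' n)"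
  have "Cauchy ?I"
  proof (rule metric_CauchyI)
    fix e :: real assume e: "e > 0"
    then have "ennreal (e / 2) > 0" by simp
    then have "eventually (\<lambda>n. (\<integral>\<^sup>+t. ennreal (norm (h t - s' n t)) \<partial>M) < ennreal (e / 2)) sequentially"
      using lim0 by (intro order_tendstoD(2)) auto
    then obtain N where N: "\<And>n. n \<ge> N \<Longrightarrow> (\<integral>\<^sup>+t. ennreal (norm (h t - s' n t)) \<partial>M) < ennreal (e / 2)"
      by (auto simp: eventually_sequentially)
    have "dist (?I m) (?I n) < e" if "m \<ge> N" "n \<ge> N" for m n
    proof -
      have "ennreal (norm (?I m - ?I n)) \<le>
          (\<integral>\<^sup>+ x. norm (h x - s' m x) \<partial>M) + (\<integral>\<^sup>+ x. norm (h x - s' n x) \<partial>M)"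
        by (rule simple_bochner_integral_dist_le[OF h s'_int s'_int])
      also have "\<dots> < ennreal (e / 2) + ennreal (e / 2)"
        using N that by (intro add_strict_mono) auto
      also have "\<dots> = ennreal e" using e by (simp flip: ennreal_plus)
      finally show ?thesis using e by (simp add: dist_norm ennreal_less_iff)
    qed
    then show "\<exists>N. \<forall>m\<ge>N. \<forall>n\<ge>N. dist (?I m) (?I n) < e" by blast
  qed
  then obtain J where "?I \<longlonglongrightarrow> J" by (auto simp: Cauchy_convergent_iff convergent_def)
  then have "has_strong_bochner_integral M h J"
    unfolding has_strong_bochner_integral_def using h s'_int lim0 by auto
  then show ?thesis by (rule that)
qed

text \<open>A functional maps simple approximations to simple approximations and enlarges the
  integrated error by at most its norm. This reduces computations with vector integrals to real
  ones.\<close>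

lemma (in complete_measure) has_bochner_integral_functional:
  fixes h :: "'a \<Rightarrow> 'b::real_normed_vector" and \<phi> :: "'b \<Rightarrow>\<^sub>L real"
  assumes "has_strong_bochner_integral M h J"
  shows "has_bochner_integral M (\<lambda>t. \<phi> (h t)) (\<phi> J)"
proof -
  have h: "strongly_measurable M h" using assms by (simp add: has_strong_bochner_integral_def)
  obtain s where s: "\<And>n. Bochner_Integration.simple_bochner_integrable M (s n)"
    and lim0: "(\<lambda>n. \<integral>\<^sup>+t. ennreal (norm (h t - s n t)) \<partial>M) \<longlonglongrightarrow> 0"
    and limJ: "(\<lambda>n. Bochner_Integration.simple_bochner_integral M (s n)) \<longlonglongrightarrow> J"
    using assms unfolding has_strong_bochner_integral_def by blast
  have sf: "simple_function M (s n)" for n using s[of n] by (auto elim: simple_bochner_integrable.cases)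
  show ?thesis
  proof (rule has_bochner_integral.intros)
    show "(\<lambda>t. \<phi> (h t)) \<in> borel_measurable M"
      using h by (rule strongly_measurable_isCont) (intro continuous_intros)
    show "Bochner_Integration.simple_bochner_integrable M (\<lambda>t. \<phi> (s n t))" for n
      using simple_bochner_integrable_compose2[of "\<lambda>x y. \<phi> x" M "s n" "s n"] s by simp
    have "(\<lambda>n. Bochner_Integration.simple_bochner_integral M (\<lambda>t. \<phi> (s n t))) =
        (\<lambda>n. \<phi> (Bochner_Integration.simple_bochner_integral M (s n)))"
      using s by (intro ext simple_bochner_integral_linear) (auto intro: bounded_linear.linear blinfun.bounded_linear_right)
    then show "(\<lambda>n. Bochner_Integration.simple_bochner_integral M (\<lambda>t. \<phi> (s n t))) \<longlonglongrightarrow> \<phi> J"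
      using limJ by (simp add: blinfun.tendsto)
    have up: "(\<lambda>n. ennreal (norm \<phi>) * (\<integral>\<^sup>+t. ennreal (norm (h t - s n t)) \<partial>M)) \<longlonglongrightarrow> ennreal (norm \<phi>) * 0"
      by (intro ennreal_tendsto_cmult lim0) simp
    have le: "(\<integral>\<^sup>+t. ennreal (norm (\<phi> (h t) - \<phi> (s n t))) \<partial>M) \<le>
        ennreal (norm \<phi>) * (\<integral>\<^sup>+t. ennreal (norm (h t - s n t)) \<partial>M)" for n
    proof -
      have "(\<integral>\<^sup>+t. ennreal (norm (\<phi> (h t) - \<phi> (s n t))) \<partial>M)
          \<le> (\<integral>\<^sup>+t. ennreal (norm \<phi>) * ennreal (norm (h t - s n t)) \<partial>M)"
        using norm_blinfun[of \<phi>]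
        by (intro nn_integral_mono) (auto simp: blinfun.diff_right[symmetric] ennreal_mult[symmetric] intro!: ennreal_leI)
      also have "\<dots> = ennreal (norm \<phi>) * (\<integral>\<^sup>+t. ennreal (norm (h t - s n t)) \<partial>M)"
        using strongly_measurable_norm_diff_simple[OF h sf] by (intro nn_integral_cmult) simp
      finally show ?thesis .
    qed
    show "(\<lambda>n. \<integral>\<^sup>+t. ennreal (norm (\<phi> (h t) - \<phi> (s n t))) \<partial>M) \<longlonglongrightarrow> 0"
      by (rule tendsto_sandwich[OF _ _ tendsto_const up[unfolded mult_zero_right]])
        (rule always_eventually, simp, rule always_eventually, rule allI, rule le)
  qed
qed

text \<open>For the gauge integral, additivity over adjacent intervals and insensitivity to single
  points are at hand; both are used below on tested integrands.\<close>

lemma has_strong_bochner_integral_has_integral: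
  fixes \<phi> :: "'a::real_normed_vector \<Rightarrow>\<^sub>L real" and S :: "real set"
  assumes "has_strong_bochner_integral (lebesgue_on S) h J" "S \<in> sets lebesgue"
  shows "((\<lambda>t. \<phi> (h t)) has_integral \<phi> J) S"
proof -
  have "has_bochner_integral (lebesgue_on S) (\<lambda>t. \<phi> (h t)) (\<phi> J)"
    using complete_measure_lebesgue_on[OF assms(2)] assms(1)
    by (rule complete_measure.has_bochner_integral_functional)
  then show ?thesis
    using has_integral_integral_lebesgue_on[OF _ assms(2), of "\<lambda>t. \<phi> (h t)"]
    by (simp add: has_bochner_integral_iff)
qed

section \<open>Weak solutions of ordinary differential equations\<close>

lemma has_strong_bochner_integral_norm_le:
  fixes h :: "real \<Rightarrow> 'a::real_normed_vector"
  assumes J: "has_strong_bochner_integral (lebesgue_on {a..b}) h J" and ab: "a \<le> b"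
    and K: "\<And>t. t \<in> {a..b} \<Longrightarrow> norm (h t) \<le> K"
  shows "norm J \<le> K * (b - a)"
proof (rule norm_le_functional)
  fix \<phi> :: "'a \<Rightarrow>\<^sub>L real" assume \<phi>: "\<And>y. \<bar>\<phi> y\<bar> \<le> norm y"
  have K0: "0 \<le> K" using order_trans[OF norm_ge_zero K[of a]] ab by simp
  have "((\<lambda>t. \<phi> (h t)) has_integral \<phi> J) {a..b}"
    using J by (rule has_strong_bochner_integral_has_integral) simp
  moreover have "norm (\<phi> (h t)) \<le> K" if "t \<in> {a..b}" for t
    using \<phi>[of "h t"] K[OF that] by simp
  ultimately have "norm (\<phi> J) \<le> K * measure lborel {a..b}"
    by (intro has_integral_bound_real[OF K0 finite.emptyI]) auto
  then show "\<phi> J \<le> K * (b - a)" using ab by simp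
qed

lemma bounded_interval_has_strong_bochner_integral:
  fixes h :: "real \<Rightarrow> 'a::banach"
  assumes h: "strongly_measurable (lebesgue_on {c..d}) h"
    and K: "\<And>t. t \<in> {a..b} \<Longrightarrow> norm (h t) \<le> K" and sub: "{a..b} \<subseteq> {c..d}"
  obtains J where "has_strong_bochner_integral (lebesgue_on {a..b}) h J"
proof -
  interpret complete_measure "lebesgue_on {a..b}" by (rule complete_measure_lebesgue_on) simp
  have "finite_measure (lebesgue_on {a..b})" by (rule finite_measure_lebesgue_on) simp
  moreover have "strongly_measurable (lebesgue_on {a..b}) h"
    using h sub by (rule strongly_measurable_subset) auto
  ultimately show ?thesis
    by (rule bounded_has_strong_bochner_integral[where K = K]) (use K that in auto)
qed

text \<open>Supplies the switching index of the Euler step functions: a bounded interval meets only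
  finitely many grid cells.\<close>

lemma simple_function_floor:
  fixes \<delta> T :: real
  assumes "\<delta> > 0"
  shows "simple_function (lebesgue_on {0..T}) (\<lambda>t. nat \<lfloor>t / \<delta>\<rfloor>)"
proof (subst simple_function_def, intro conjI ballI)
  have "nat \<lfloor>t / \<delta>\<rfloor> \<le> nat \<lfloor>T / \<delta>\<rfloor>" if "t \<in> {0..T}" for t
    using that assms by (intro nat_mono floor_mono divide_right_mono) auto
  then have "(\<lambda>t. nat \<lfloor>t / \<delta>\<rfloor>) ` {0..T} \<subseteq> {..nat \<lfloor>T / \<delta>\<rfloor>}" by auto
  then show "finite ((\<lambda>t. nat \<lfloor>t / \<delta>\<rfloor>) ` space (lebesgue_on {0..T}))"
    by (simp add: finite_subset)
  fix k
  have "{t \<in> space borel. nat \<lfloor>t / \<delta>\<rfloor> = k} \<in> sets borel" by measurable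
  then have "{t. nat \<lfloor>t / \<delta>\<rfloor> = k} \<in> sets lebesgue" by simp
  then have "{t. nat \<lfloor>t / \<delta>\<rfloor> = k} \<inter> {0..T} \<in> sets lebesgue" by simp
  moreover have "(\<lambda>t. nat \<lfloor>t / \<delta>\<rfloor>) -` {k} \<inter> space (lebesgue_on {0..T}) = {t. nat \<lfloor>t / \<delta>\<rfloor> = k} \<inter> {0..T}"
    by auto
  ultimately show "(\<lambda>t. nat \<lfloor>t / \<delta>\<rfloor>) -` {k} \<inter> space (lebesgue_on {0..T}) \<in> sets (lebesgue_on {0..T})"
    by (simp add: sets_restrict_space_iff)
qed

lemma functional_integrable:
  fixes h :: "real \<Rightarrow> 'a::banach" and \<phi> :: "'a \<Rightarrow>\<^sub>L real"
  assumes h: "strongly_measurable (lebesgue_on {c..d}) h"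
    and K: "\<And>t. t \<in> {c..d} \<Longrightarrow> norm (h t) \<le> K" and sub: "{a..b} \<subseteq> {c..d}"
  shows "(\<lambda>t. \<phi> (h t)) integrable_on {a..b}"
proof -
  obtain J where "has_strong_bochner_integral (lebesgue_on {a..b}) h J"
    by (rule bounded_interval_has_strong_bochner_integral[OF h, of a b K]) (use K sub in auto)
  then have "((\<lambda>t. \<phi> (h t)) has_integral \<phi> J) {a..b}"
    by (rule has_strong_bochner_integral_has_integral) simp
  then show ?thesis by blast
qed

lemma indefinite_integral_lipschitz:
  fixes f :: "real \<Rightarrow> real"
  assumes int: "f integrable_on {0..T}" and A: "\<And>t. t \<in> {0..T} \<Longrightarrow> \<bar>f t\<bar> \<le> A"
    and st: "s \<in> {0..T}" "t \<in> {0..T}"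
  shows "\<bar>integral {0..s} f - integral {0..t} f\<bar> \<le> A * \<bar>s - t\<bar>"
proof -
  have *: "\<bar>integral {0..s} f - integral {0..t} f\<bar> \<le> A * \<bar>s - t\<bar>"
    if st: "s \<in> {0..T}" "t \<in> {0..T}" "t \<le> s" for s t
  proof -
    have A0: "0 \<le> A" using order_trans[OF abs_ge_zero A[of s]] st by simp
    have sub: "f integrable_on {0..s}" "f integrable_on {t..s}"
      using st by (auto intro: integrable_on_subinterval[OF int])
    have "integral {0..t} f + integral {t..s} f = integral {0..s} f"
      using st sub by (intro Henstock_Kurzweil_Integration.integral_combine) auto
    moreover have "norm (integral {t..s} f) \<le> A * measure lborel {t..s}"
      using sub(2) A st by (intro has_integral_bound_real[OF A0 finite.emptyI, of f]) auto
    ultimately show ?thesis using st by simp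
  qed
  show ?thesis using *[of s t] *[of t s] st by (cases "t \<le> s") (auto simp: abs_minus_commute)
qed

text \<open>The recursion is only recorded after testing with functionals: this is the form that passes to
  weak limits.\<close>

lemma euler_scheme:
  fixes G :: "real \<Rightarrow> 'a::banach \<Rightarrow> 'a"
  assumes T: "T > 0" and N: "N > (0::nat)"
    and meas: "\<And>x. strongly_measurable (lebesgue_on {0..T}) (\<lambda>t. G t x)"
    and bound: "\<And>t x. t \<in> {0..T} \<Longrightarrow> norm x \<le> M * T \<Longrightarrow> norm (G t x) \<le> M"
    and M: "M \<ge> 0"
  obtains w :: "real \<Rightarrow> 'a" where "strongly_measurable (lebesgue_on {0..T}) (\<lambda>t. G t (w t))"
    "\<And>t. t \<in> {0..T} \<Longrightarrow> norm (w t) \<le> M * T"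
    "\<And>(\<phi> :: 'a \<Rightarrow>\<^sub>L real) t. t \<in> {0..T} \<Longrightarrow>
       \<bar>blinfun_apply \<phi> (w t) - integral {0..t} (\<lambda>s. blinfun_apply \<phi> (G s (w s)))\<bar> \<le> M * norm \<phi> * (T / N)"
proof -
  define \<delta> where "\<delta> = T / N"
  have \<delta>: "\<delta> > 0" "N * \<delta> = T" using T N by (auto simp: \<delta>_def)
  \<comment> \<open>The integral over the k-th grid cell with the state frozen at y. The choice is
    known to be an integral for k < N and y in the ball of radius M T; \<open>x_bound\<close> keeps
    the recursion there.\<close>
  define J where "J k y = (SOME J. has_strong_bochner_integral (lebesgue_on {real k * \<delta>..(real k + 1) * \<delta>}) (\<lambda>t. G t y) J)"
    for k :: nat and y
  define x where "x = rec_nat (0 :: 'a) (\<lambda>k y. y + J k y)"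
  have x_simps: "x 0 = 0" "x (Suc k) = x k + J k (x k)" for k by (auto simp: x_def)
  have sub: "{real k * \<delta>..(real k + 1) * \<delta>} \<subseteq> {0..T}" if "k < N" for k
  proof -
    have "(real k + 1) * \<delta> \<le> N * \<delta>" using that \<delta> by (intro mult_right_mono) auto
    then show ?thesis using \<delta> by auto
  qed
  have J: "has_strong_bochner_integral (lebesgue_on {real k * \<delta>..(real k + 1) * \<delta>}) (\<lambda>t. G t y) (J k y)"
    if ky: "k < N" "norm y \<le> M * T" for k y
  proof -
    obtain J' where "has_strong_bochner_integral (lebesgue_on {real k * \<delta>..(real k + 1) * \<delta>}) (\<lambda>t. G t y) J'"
      by (rule bounded_interval_has_strong_bochner_integral[OF meas, of "real k * \<delta>" "(real k + 1) * \<delta>" y M])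
        (use bound sub[OF ky(1)] ky(2) in auto)
    then show ?thesis unfolding J_def by (rule someI)
  qed
  have kT: "M * (k * \<delta>) \<le> M * T" if "k \<le> N" for k
  proof -
    have "real k * \<delta> \<le> N * \<delta>" using that \<delta> by (intro mult_right_mono) auto
    then show ?thesis using M \<delta> by (intro mult_left_mono) auto
  qed
  have x_bound: "norm (x k) \<le> M * (k * \<delta>)" if "k \<le> N" for k
    using that
  proof (induction k)
    case (Suc k)
    then have IH: "norm (x k) \<le> M * (k * \<delta>)" and k: "k < N" by auto
    then have xk: "norm (x k) \<le> M * T" using kT[of k] by simp
    have "norm (G t (x k)) \<le> M" if "t \<in> {real k * \<delta>..(real k + 1) * \<delta>}" for t
      using sub[OF k] bound xk that by blast
    then have "norm (J k (x k)) \<le> M * ((real k + 1) * \<delta> - k * \<delta>)"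
      using \<delta> by (intro has_strong_bochner_integral_norm_le[OF J[OF k xk]]) auto
    then show ?case
      using IH norm_triangle_ineq[of "x k" "J k (x k)"] by (simp add: x_simps algebra_simps)
  qed (simp add: x_simps)
  define w where "w t = x (nat \<lfloor>t / \<delta>\<rfloor>)" for t
  have idx: "nat \<lfloor>t / \<delta>\<rfloor> \<le> N" "real (nat \<lfloor>t / \<delta>\<rfloor>) * \<delta> \<le> t" "t \<le> real (nat \<lfloor>t / \<delta>\<rfloor>) * \<delta> + \<delta>"
    if "t \<in> {0..T}" for t
  proof -
    have "t / \<delta> \<le> N" using that \<delta> by (simp add: field_simps)
    then show "nat \<lfloor>t / \<delta>\<rfloor> \<le> N" by linarith
    have 0: "t / \<delta> \<ge> 0" using that \<delta> by simp
    then have "real (nat \<lfloor>t / \<delta>\<rfloor>) \<le> t / \<delta>" by linarith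
    then show "real (nat \<lfloor>t / \<delta>\<rfloor>) * \<delta> \<le> t" using \<delta> by (simp add: field_simps)
    have "t / \<delta> \<le> real (nat \<lfloor>t / \<delta>\<rfloor>) + 1" using 0 by linarith
    then show "t \<le> real (nat \<lfloor>t / \<delta>\<rfloor>) * \<delta> + \<delta>" using \<delta> by (simp add: field_simps)
  qed
  have w_bound: "norm (w t) \<le> M * T" if "t \<in> {0..T}" for t
    using x_bound[OF idx(1)[OF that]] kT[OF idx(1)[OF that]] unfolding w_def by simp
  have w_meas: "strongly_measurable (lebesgue_on {0..T}) (\<lambda>t. G t (w t))"
    unfolding w_def using meas simple_function_floor[OF \<delta>(1)] by (rule strongly_measurable_piecewise)
  have Gw: "norm (G t (w t)) \<le> M" if "t \<in> {0..T}" for t using bound w_bound that by blast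
  have grid: "((\<lambda>s. \<phi> (G s (w s))) has_integral \<phi> (x k)) {0..real k * \<delta>}"
    if "k \<le> N" for \<phi> :: "'a \<Rightarrow>\<^sub>L real" and k
    using that
  proof (induction k)
    case 0
    then show ?case
      using has_integral_refl(2)[of "\<lambda>s. \<phi> (G s (w s))" "0::real"] by (simp add: x_simps)
  next
    case (Suc k)
    then have k: "k < N" by simp
    have xk: "norm (x k) \<le> M * T" using x_bound[of k] kT[of k] k by simp
    have "((\<lambda>s. \<phi> (G s (x k))) has_integral \<phi> (J k (x k))) {real k * \<delta>..(real k + 1) * \<delta>}"
      using J[OF k xk] by (rule has_strong_bochner_integral_has_integral) simp
    then have "((\<lambda>s. \<phi> (G s (w s))) has_integral \<phi> (J k (x k))) {real k * \<delta>..(real k + 1) * \<delta>}"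
    \<comment> \<open>At the right end of the cell the floor has already jumped to k + 1; this
      single point is exempted.\<close>
    proof (rule has_integral_spike_finite[of "{(real k + 1) * \<delta>}", rotated 2])
      fix s assume s: "s \<in> {real k * \<delta>..(real k + 1) * \<delta>} - {(real k + 1) * \<delta>}"
      then have "real k \<le> s / \<delta>" "s / \<delta> < real k + 1"
        using \<delta> by (auto simp: field_simps)
      then have "nat \<lfloor>s / \<delta>\<rfloor> = k" by linarith
      then show "\<phi> (G s (w s)) = \<phi> (G s (x k))" by (simp add: w_def)
    qed simp
    then have "((\<lambda>s. \<phi> (G s (w s))) has_integral \<phi> (x k) + \<phi> (J k (x k))) {0..(real k + 1) * \<delta>}"
      using Suc \<delta> by (intro has_integral_combine[of 0 "k * \<delta>" "(real k + 1) * \<delta>"]) auto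
    then show ?case by (simp add: x_simps blinfun.add_right algebra_simps)
  qed
  have "\<bar>\<phi> (w t) - integral {0..t} (\<lambda>s. \<phi> (G s (w s)))\<bar> \<le> M * norm \<phi> * (T / real N)"
    if t: "t \<in> {0..T}" for \<phi> :: "'a \<Rightarrow>\<^sub>L real" and t
  proof -
    \<comment> \<open>The last grid point not after t. The tested node value is exactly the integral
      up to \<tau>, and the missing piece has length at most \<delta>.\<close>
    define \<tau> where "\<tau> = real (nat \<lfloor>t / \<delta>\<rfloor>) * \<delta>"
    have \<tau>: "\<tau> \<in> {0..T}" "\<tau> \<le> t" "t - \<tau> \<le> \<delta>" using idx[OF t] t \<delta> by (auto simp: \<tau>_def)
    have "\<phi> (w t) = integral {0..\<tau>} (\<lambda>s. \<phi> (G s (w s)))"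
      using grid[OF idx(1)[OF t], of \<phi>] unfolding w_def \<tau>_def by (rule integral_unique[symmetric])
    moreover have "\<bar>integral {0..\<tau>} (\<lambda>s. \<phi> (G s (w s))) - integral {0..t} (\<lambda>s. \<phi> (G s (w s)))\<bar>
        \<le> M * norm \<phi> * \<bar>\<tau> - t\<bar>"
      using functional_integrable[OF w_meas Gw] functional_le_norm[OF Gw] \<tau>(1) t
      by (intro indefinite_integral_lipschitz[where T = T]) auto
    moreover have "M * norm \<phi> * \<bar>\<tau> - t\<bar> \<le> M * norm \<phi> * \<delta>"
      using \<tau> M by (intro mult_left_mono) auto
    ultimately show ?thesis by (simp add: \<delta>_def)
  qed
  then show ?thesis using w_meas w_bound that by blast
qed

lemma convergent_of_equilipschitz:
  fixes c :: "nat \<Rightarrow> real \<Rightarrow> real"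
  assumes lip: "\<And>n s t. s \<in> S \<Longrightarrow> t \<in> S \<Longrightarrow> \<bar>c n s - c n t\<bar> \<le> A * \<bar>s - t\<bar>"
    and conv: "\<And>q. q \<in> Q \<Longrightarrow> convergent (\<lambda>n. c n q)"
    and dense: "Q \<subseteq> S" "S \<subseteq> closure Q" and t: "t \<in> S"
  shows "convergent (\<lambda>n. c n t)"
  unfolding Cauchy_convergent_iff[symmetric]
proof (rule metric_CauchyI)
  fix e :: real assume e: "e > 0"
  \<comment> \<open>The summand 1 keeps the denominator positive, and the absolute value is taken
    because no sign of A is assumed. Moving from t to q then costs less than e/3 for each of the two
    indices.\<close>
  define \<eta> where "\<eta> = e / (3 * (\<bar>A\<bar> + 1))"
  have \<eta>: "\<eta> > 0" using e by (simp add: \<eta>_def)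
  have A\<eta>: "\<bar>A\<bar> * \<eta> < e / 3" using e by (simp add: \<eta>_def field_simps)
  obtain q where q: "q \<in> Q" "dist q t < \<eta>"
    using t dense(2) \<eta> unfolding closure_approachable subset_iff by blast
  have near: "\<bar>c n t - c n q\<bar> < e / 3" for n
  proof -
    have "\<bar>c n t - c n q\<bar> \<le> A * \<bar>t - q\<bar>" using t q dense(1) by (intro lip) auto
    also have "\<dots> \<le> \<bar>A\<bar> * \<eta>" using q by (intro mult_mono) (auto simp: dist_real_def)
    finally show ?thesis using A\<eta> by simp
  qed
  obtain N where N: "\<And>m n. m \<ge> N \<Longrightarrow> n \<ge> N \<Longrightarrow> dist (c m q) (c n q) < e / 3"
    using conv[OF q(1)] e unfolding Cauchy_convergent_iff[symmetric] Cauchy_def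
    by (meson divide_pos_pos zero_less_numeral)
  have "dist (c m t) (c n t) < e" if "m \<ge> N" "n \<ge> N" for m n
    using N[OF that] near[of m] near[of n] unfolding dist_real_def by linarith
  then show "\<exists>N. \<forall>m\<ge>N. \<forall>n\<ge>N. dist (c m t) (c n t) < e" by blast
qed

text \<open>The approximations w are step functions and need not be continuous. The tested integrals
  \<open>c\<close>, however, are equi-Lipschitz in time and differ from the tested w by O(1/n), so
  convergence at rational times spreads to all times through \<open>c\<close>. The radius M T is
  what a start at 0 with speed at most M can reach.\<close>

theorem weak_ode_existence:
  fixes G :: "real \<Rightarrow> 'a::banach \<Rightarrow> 'a"
  assumes refl: "reflexive_space TYPE('a)" and T: "T > 0" and M: "M \<ge> 0"
    and meas: "\<And>x. strongly_measurable (lebesgue_on {0..T}) (\<lambda>t. G t x)"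
    and bound: "\<And>t x. t \<in> {0..T} \<Longrightarrow> norm x \<le> M * T \<Longrightarrow> norm (G t x) \<le> M"
    and weak: "AE t in lebesgue_on {0..T}. \<forall>xs x B. weakly_tendsto xs x \<longrightarrow> (\<forall>n. norm (xs n) \<le> B) \<longrightarrow>
      weakly_tendsto (\<lambda>n. G t (xs n)) (G t x)"
  obtains v where "M-lipschitz_on {0..T} v"
    "\<And>t. t \<in> {0..T} \<Longrightarrow> has_strong_bochner_integral (lebesgue_on {0..t}) (\<lambda>s. G s (v s)) (v t)"
proof -
  let ?\<delta> = "\<lambda>n. T / real (Suc n)"
  define E where "E n w \<longleftrightarrow> strongly_measurable (lebesgue_on {0..T}) (\<lambda>t. G t (w t)) \<and>
    (\<forall>t\<in>{0..T}. norm (w t) \<le> M * T) \<and>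
    (\<forall>(\<phi> :: 'a \<Rightarrow>\<^sub>L real). \<forall>t\<in>{0..T}.
       \<bar>blinfun_apply \<phi> (w t) - integral {0..t} (\<lambda>s. blinfun_apply \<phi> (G s (w s)))\<bar> \<le> M * norm \<phi> * ?\<delta> n)"
    for n and w :: "real \<Rightarrow> 'a"
  have "\<exists>w. E n w" for n
    unfolding E_def by (rule euler_scheme[OF T, of "Suc n" G M]) (use meas bound M in auto)
  then obtain w where w: "\<And>n. E n (w n)" by metis
  have w_meas: "strongly_measurable (lebesgue_on {0..T}) (\<lambda>t. G t (w n t))"
    and w_bound: "t \<in> {0..T} \<Longrightarrow> norm (w n t) \<le> M * T"
    and w_int: "t \<in> {0..T} \<Longrightarrow>
       \<bar>blinfun_apply \<phi> (w n t) - integral {0..t} (\<lambda>s. blinfun_apply \<phi> (G s (w n s)))\<bar> \<le> M * norm \<phi> * ?\<delta> n"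
    for n t \<phi>
    using w[of n] unfolding E_def by auto
  have Gw: "norm (G t (w n t)) \<le> M" if "t \<in> {0..T}" for n t using bound w_bound that by blast
  define c where "c \<phi> n t = integral {0..t} (\<lambda>s. blinfun_apply \<phi> (G s (w n s)))" for \<phi> :: "'a \<Rightarrow>\<^sub>L real" and n t
  have c_lip: "\<bar>c \<phi> n s - c \<phi> n t\<bar> \<le> M * norm \<phi> * \<bar>s - t\<bar>" if "s \<in> {0..T}" "t \<in> {0..T}" for \<phi> n s t
    unfolding c_def using functional_integrable[OF w_meas Gw] functional_le_norm[OF Gw] that
    by (intro indefinite_integral_lipschitz[where T = T]) auto
  have wc: "(\<lambda>n. \<phi> (w n t) - c \<phi> n t) \<longlonglongrightarrow> 0" if "t \<in> {0..T}" for \<phi> :: "'a \<Rightarrow>\<^sub>L real" and t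
  proof (rule Lim_null_comparison)
    show "\<forall>\<^sub>F n in sequentially. norm (\<phi> (w n t) - c \<phi> n t) \<le> M * norm \<phi> * ?\<delta> n"
      using w_int[OF that] by (simp add: c_def)
    show "(\<lambda>n. M * norm \<phi> * ?\<delta> n) \<longlonglongrightarrow> 0"
      using tendsto_mult_right_zero[OF lim_const_over_n[of T, THEN LIMSEQ_Suc]] by simp
  qed
  define Q where "Q = \<rat> \<inter> {0..T}"
  have "0 \<in> Q" using T by (simp add: Q_def)
  have "countable Q" unfolding Q_def using countable_rat by blast
  define q where "q = from_nat_into Q"
  have qQ: "q k \<in> Q" for k unfolding q_def using \<open>0 \<in> Q\<close> by (intro from_nat_into) auto
  then have qT: "q k \<in> {0..T}" for k unfolding Q_def by blast
  have q_surj: "\<exists>k. q k = y" if "y \<in> Q" for y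
    unfolding q_def using that \<open>countable Q\<close> by (metis from_nat_into_surj)
  have dense: "{0..T} \<subseteq> closure Q"
  proof
    fix t assume t: "t \<in> {0..T}"
    show "t \<in> closure Q"
    proof (unfold closure_approachable, intro allI impI)
      fix e :: real assume e: "e > 0"
      show "\<exists>y\<in>Q. dist y t < e"
      proof (cases "t = 0")
        case True
        then show ?thesis using \<open>0 \<in> Q\<close> e by (intro bexI[of _ 0]) auto
      next
        case False
        then have "max 0 (t - e) < t" using t e by auto
        then obtain y where "max 0 (t - e) < of_rat y" "of_rat y < t" using of_rat_dense by blast
        then show ?thesis
          using t by (intro bexI[of _ "of_rat y"]) (auto simp: Q_def dist_real_def)
      qed
    qed
  qed
  obtain r where r: "strict_mono r" "\<And>k. \<exists>z. weakly_tendsto (\<lambda>n. w (r n) (q k)) z"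
  proof (rule diagonal_subseq[of "\<lambda>k s. \<exists>z. weakly_tendsto (\<lambda>n. w (s n) (q k)) z"])
    fix k and s :: "nat \<Rightarrow> nat"
    obtain r z where "strict_mono r" "weakly_tendsto ((\<lambda>n. w (s n) (q k)) \<circ> r) z"
      by (rule reflexive_weak_subseq[OF refl, of "\<lambda>n. w (s n) (q k)" "M * T"]) (use w_bound qT in auto)
    then show "\<exists>r. strict_mono r \<and> (\<exists>z. weakly_tendsto (\<lambda>n. w ((s \<circ> r) n) (q k)) z)"
      by (auto simp: o_def)
  next
    fix k and s r :: "nat \<Rightarrow> nat"
    assume r: "strict_mono r" and "\<exists>z. weakly_tendsto (\<lambda>n. w (s n) (q k)) z"
    then obtain z where "weakly_tendsto (\<lambda>n. w (s n) (q k)) z" by blast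
    from weakly_tendsto_subseq[OF this r]
    show "\<exists>z. weakly_tendsto (\<lambda>n. w ((s \<circ> r) n) (q k)) z" by (auto simp: o_def)
  next
    fix k and s :: "nat \<Rightarrow> nat"
    assume "\<exists>z. weakly_tendsto (\<lambda>n. w ((s \<circ> (+) (Suc k)) n) (q k)) z"
    then obtain z where z: "weakly_tendsto (\<lambda>n. w (s (Suc k + n)) (q k)) z" by auto
    have "weakly_tendsto (\<lambda>n. w (s n) (q k)) z"
      unfolding weakly_tendsto_def
    proof
      fix \<phi> :: "'a \<Rightarrow>\<^sub>L real"
      have "(\<lambda>n. \<phi> (w (s (n + Suc k)) (q k))) \<longlonglongrightarrow> \<phi> z"
        using weakly_tendstoD[OF z, of \<phi>] by (simp add: add.commute)
      then show "(\<lambda>n. \<phi> (w (s n) (q k))) \<longlonglongrightarrow> \<phi> z" by (rule LIMSEQ_offset)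
    qed
    then show "\<exists>z. weakly_tendsto (\<lambda>n. w (s n) (q k)) z" by blast
  qed blast
  have wcr: "(\<lambda>n. \<phi> (w (r n) t) - c \<phi> (r n) t) \<longlonglongrightarrow> 0" if "t \<in> {0..T}" for \<phi> :: "'a \<Rightarrow>\<^sub>L real" and t
    using LIMSEQ_subseq_LIMSEQ[OF wc[OF that] r(1)] by (simp add: o_def)
  have c_conv: "convergent (\<lambda>n. c \<phi> (r n) t)" if t: "t \<in> {0..T}" for \<phi> :: "'a \<Rightarrow>\<^sub>L real" and t
  proof (rule convergent_of_equilipschitz[of "{0..T}" _ "M * norm \<phi>" Q])
    fix y assume y: "y \<in> Q"
    then obtain k where k: "q k = y" using q_surj by blast
    obtain z where "weakly_tendsto (\<lambda>n. w (r n) y) z" using r(2)[of k] k by blast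
    then have "(\<lambda>n. \<phi> (w (r n) y) - (\<phi> (w (r n) y) - c \<phi> (r n) y)) \<longlonglongrightarrow> \<phi> z - 0"
      using wcr[of y \<phi>] y unfolding Q_def by (intro tendsto_diff weakly_tendstoD) auto
    then show "convergent (\<lambda>n. c \<phi> (r n) y)" by (auto simp: convergent_def)
  qed (use c_lip dense t in \<open>auto simp: Q_def\<close>)
  have "\<exists>z. weakly_tendsto (\<lambda>n. w (r n) t) z" if t: "t \<in> {0..T}" for t
  proof (rule weakly_convergentI[OF refl])
    show "norm (w (r n) t) \<le> M * T" for n using w_bound t by blast
    show "convergent (\<lambda>n. \<phi> (w (r n) t))" for \<phi> :: "'a \<Rightarrow>\<^sub>L real"
      using convergent_add[OF convergentI[OF wcr[OF t, of \<phi>]] c_conv[OF t, of \<phi>]] by simp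
  qed blast
  then obtain v where v: "\<And>t. t \<in> {0..T} \<Longrightarrow> weakly_tendsto (\<lambda>n. w (r n) t) (v t)" by metis
  have cv: "(\<lambda>n. c \<phi> (r n) t) \<longlonglongrightarrow> \<phi> (v t)" if t: "t \<in> {0..T}" for \<phi> :: "'a \<Rightarrow>\<^sub>L real" and t
    using tendsto_diff[OF weakly_tendstoD[OF v[OF t], of \<phi>] wcr[OF t, of \<phi>]] by simp
  have "M-lipschitz_on {0..T} v"
  proof (rule lipschitz_onI[OF _ M])
    fix s t assume st: "s \<in> {0..T}" "t \<in> {0..T}"
    have "norm (v s - v t) \<le> M * \<bar>s - t\<bar>"
    proof (rule norm_le_functional)
      fix \<phi> :: "'a \<Rightarrow>\<^sub>L real" assume \<phi>: "\<And>y. \<bar>\<phi> y\<bar> \<le> norm y"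
      then have "norm \<phi> \<le> 1" by (intro norm_blinfun_bound) auto
      then have "M * norm \<phi> * \<bar>s - t\<bar> \<le> M * 1 * \<bar>s - t\<bar>"
        using M by (intro mult_right_mono mult_left_mono) auto
      moreover have "c \<phi> (r n) s - c \<phi> (r n) t \<le> M * norm \<phi> * \<bar>s - t\<bar>" for n
        using c_lip[OF st, of \<phi> "r n"] by (simp add: abs_le_iff)
      then have "\<phi> (v s) - \<phi> (v t) \<le> M * norm \<phi> * \<bar>s - t\<bar>"
        using tendsto_diff[OF cv[OF st(1), of \<phi>] cv[OF st(2), of \<phi>]] by (intro Lim_bounded) auto
      ultimately show "\<phi> (v s - v t) \<le> M * \<bar>s - t\<bar>" by (simp add: blinfun.diff_right)
    qed
    then show "dist (v s) (v t) \<le> M * dist s t" by (simp add: dist_norm)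
  qed
  moreover have v_bound: "norm (v t) \<le> M * T" if "t \<in> {0..T}" for t
    using v[OF that] w_bound[OF that] by (rule weakly_tendsto_norm_bound)
  have Gv: "norm (G t (v t)) \<le> M" if "t \<in> {0..T}" for t using bound v_bound that by blast
  \<comment> \<open>The states converge weakly at every t; the exceptional null set stems solely
    from the weak continuity of G.\<close>
  have lim: "AE t in lebesgue_on {0..T}. weakly_tendsto (\<lambda>n. G t (w (r n) t)) (G t (v t))"
    using weak AE_space
  proof eventually_elim
    case (elim t)
    then have t: "t \<in> {0..T}" by simp
    show ?case using elim(1) v[OF t] w_bound[OF t] by blast
  qed
  have Gv_meas: "strongly_measurable (lebesgue_on {0..T}) (\<lambda>t. G t (v t))"
    by (rule complete_measure.strongly_measurable_weak_limit[where hs = "\<lambda>n t. G t (w (r n) t)",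
          OF complete_measure_lebesgue_on w_meas lim]) simp
  have "has_strong_bochner_integral (lebesgue_on {0..t}) (\<lambda>s. G s (v s)) (v t)" if t: "t \<in> {0..T}" for t
  proof -
    have sub: "{0..t} \<subseteq> {0..T}" using t by auto
    obtain J where J: "has_strong_bochner_integral (lebesgue_on {0..t}) (\<lambda>s. G s (v s)) J"
      by (rule bounded_interval_has_strong_bochner_integral[OF Gv_meas, of 0 t M]) (use Gv sub in auto)
    interpret L: complete_measure "lebesgue_on {0..t}" by (rule complete_measure_lebesgue_on) simp
    have fin: "finite_measure (lebesgue_on {0..t})" by (rule finite_measure_lebesgue_on) simp
    \<comment> \<open>J exists by boundedness and measurability alone. Its identity with v(t) is
      tested with functionals: \<open>c\<close> tends to \<phi>(v(t)) by the choice of v, and to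
      \<phi>(J) by dominated convergence.\<close>
    have "v t = J"
    proof (rule functional_eqI)
      fix \<phi> :: "'a \<Rightarrow>\<^sub>L real"
      have Jw: "\<exists>J. has_bochner_integral (lebesgue_on {0..t}) (\<lambda>s. \<phi> (G s (w n s))) J" for n
      proof -
        obtain J where "has_strong_bochner_integral (lebesgue_on {0..t}) (\<lambda>s. G s (w n s)) J"
          by (rule bounded_interval_has_strong_bochner_integral[OF w_meas[of n], of 0 t M]) (use Gw sub in auto)
        then show ?thesis using L.has_bochner_integral_functional by blast
      qed
      have c_eq: "c \<phi> n t = (\<integral>s. \<phi> (G s (w n s)) \<partial>lebesgue_on {0..t})" for n
        unfolding c_def using Jw[of n] by (intro lebesgue_integral_eq_integral[symmetric]) (auto simp: has_bochner_integral_iff)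
      have "(\<lambda>n. \<integral>s. \<phi> (G s (w (r n) s)) \<partial>lebesgue_on {0..t}) \<longlonglongrightarrow> (\<integral>s. \<phi> (G s (v s)) \<partial>lebesgue_on {0..t})"
      proof (rule integral_dominated_convergence[where w = "\<lambda>_. M * norm \<phi>"])
        show "(\<lambda>s. \<phi> (G s (v s))) \<in> borel_measurable (lebesgue_on {0..t})"
          using L.has_bochner_integral_functional[OF J, of \<phi>] by (auto elim: has_bochner_integral.cases)
        show "(\<lambda>s. \<phi> (G s (w (r n) s))) \<in> borel_measurable (lebesgue_on {0..t})" for n
          using Jw[of "r n"] by (auto elim: has_bochner_integral.cases)
        show "integrable (lebesgue_on {0..t}) (\<lambda>_. M * norm \<phi>)"
          using fin by (rule finite_measure.integrable_const)
        have "AE s in lebesgue_on {0..t}. weakly_tendsto (\<lambda>n. G s (w (r n) s)) (G s (v s))"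
          using lim sub by (auto simp: AE_restrict_space_iff)
        then show "AE s in lebesgue_on {0..t}. (\<lambda>n. \<phi> (G s (w (r n) s))) \<longlonglongrightarrow> \<phi> (G s (v s))"
          by eventually_elim (rule weakly_tendstoD)
        show "AE s in lebesgue_on {0..t}. norm (\<phi> (G s (w (r n) s))) \<le> M * norm \<phi>" for n
          using AE_space by eventually_elim (use functional_le_norm[OF Gw] sub in auto)
      qed
      then have "(\<lambda>n. c \<phi> (r n) t) \<longlonglongrightarrow> \<phi> J"
        using L.has_bochner_integral_functional[OF J, of \<phi>] by (simp add: c_eq has_bochner_integral_iff)
      then show "\<phi> (v t) = \<phi> J" using cv[OF t] LIMSEQ_unique by blast
    qed
    with J show ?thesis by simp
  qed
  ultimately show ?thesis by (rule that)
qed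

section \<open>Almost everywhere differentiability and the integral equation\<close>

text \<open>The underlying differentiation theorem concerns intervals to the right of a point.
  Left-hand quotients come from the reflected function, whose exceptional set is reflected back;
  extension by 0 makes the function integrable on every interval.\<close>

lemma lebesgue_differentiation_interval:
  fixes f :: "real \<Rightarrow> real"
  assumes f: "f integrable_on {a..b}"
  obtains N where "negligible N"
    "\<And>t e. t \<in> {a<..<b} \<Longrightarrow> t \<notin> N \<Longrightarrow> e > 0 \<Longrightarrow> \<exists>d>0. \<forall>s\<in>{a..b}. \<bar>s - t\<bar> < d \<longrightarrow>
       \<bar>integral {a..s} f - integral {a..t} f - (s - t) * f t\<bar> \<le> e * \<bar>s - t\<bar>"
proof -
  define F where "F x = (if x \<in> {a..b} then f x else 0)" for x
  have "F integrable_on UNIV" unfolding F_def using f by (simp only: integrable_restrict_UNIV)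
  then have F: "F integrable_on {c..d}" for c d
    using integrable_on_subcbox[of F UNIV c d] by simp
  then have F': "(\<lambda>x. F (- x)) integrable_on {c..d}" for c d
    using Henstock_Kurzweil_Integration.integrable_reflect_real[where f = F and a = "- d" and b = "- c"] by simp
  obtain N1 where N1: "negligible N1" "\<And>x e. x \<notin> N1 \<Longrightarrow> 0 < e \<Longrightarrow>
      \<exists>d>0. \<forall>h. 0 < h \<and> h < d \<longrightarrow> norm (integral (cbox x (x + h *\<^sub>R One)) F /\<^sub>R h ^ DIM(real) - F x) < e"
    using integrable_ccontinuous_explicit[of F] F by (metis interval_cbox)
  obtain N2 where N2: "negligible N2" "\<And>x e. x \<notin> N2 \<Longrightarrow> 0 < e \<Longrightarrow>
      \<exists>d>0. \<forall>h. 0 < h \<and> h < d \<longrightarrow> norm (integral (cbox x (x + h *\<^sub>R One)) (\<lambda>x. F (- x)) /\<^sub>R h ^ DIM(real) - F (- x)) < e"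
    using integrable_ccontinuous_explicit[of "\<lambda>x. F (- x)"] F' by (metis interval_cbox)
  have "negligible (uminus ` N2)"
    using N2(1) by (intro negligible_differentiable_image_negligible) (auto intro: derivative_intros)
  with N1(1) have "negligible (N1 \<union> uminus ` N2)" by (rule negligible_Un)
  moreover have "\<exists>d>0. \<forall>s\<in>{a..b}. \<bar>s - t\<bar> < d \<longrightarrow>
       \<bar>integral {a..s} f - integral {a..t} f - (s - t) * f t\<bar> \<le> e * \<bar>s - t\<bar>"
    if t: "t \<in> {a<..<b}" and tN: "t \<notin> N1 \<union> uminus ` N2" and e: "e > 0" for t e
  proof -
    have split: "integral {a..y} f - integral {a..x} f = integral {x..y} F"
      if "a \<le> x" "x \<le> y" "y \<le> b" for x y
    proof -
      have "integral {a..x} f + integral {x..y} f = integral {a..y} f"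
        using that by (intro Henstock_Kurzweil_Integration.integral_combine)
          (auto intro: integrable_on_subinterval[OF f])
      moreover have "integral {x..y} F = integral {x..y} f"
        using that by (intro integral_cong) (auto simp: F_def)
      ultimately show ?thesis by simp
    qed
    have Ft: "F t = f t" using t by (simp add: F_def)
    have tN': "t \<notin> N1" "- t \<notin> N2" using tN by (auto simp: image_iff)
    obtain d1 where d1: "d1 > 0" "\<And>h. 0 < h \<Longrightarrow> h < d1 \<Longrightarrow> \<bar>integral {t..t + h} F / h - f t\<bar> < e"
      using N1(2)[OF tN'(1) e] by (auto simp: Ft divide_inverse mult.commute)
    obtain d2 where d2: "d2 > 0"
        "\<And>h. 0 < h \<Longrightarrow> h < d2 \<Longrightarrow> \<bar>integral {- t..- t + h} (\<lambda>x. F (- x)) / h - f t\<bar> < e"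
      using N2(2)[OF tN'(2) e] by (auto simp: Ft divide_inverse mult.commute)
    have mult: "\<bar>I - h * y\<bar> \<le> e * h" if "\<bar>I / h - y\<bar> < e" "h > 0" for I h y :: real
    proof -
      have "\<bar>I - h * y\<bar> = \<bar>(I / h - y) * h\<bar>" using that(2) by (simp add: algebra_simps)
      also have "\<dots> \<le> e * h" using that by (simp add: abs_mult)
      finally show ?thesis .
    qed
    have "\<bar>integral {a..s} f - integral {a..t} f - (s - t) * f t\<bar> \<le> e * \<bar>s - t\<bar>"
      if s: "s \<in> {a..b}" "\<bar>s - t\<bar> < min d1 d2" for s
    proof (cases s t rule: linorder_cases)
      case greater
      have "\<bar>integral {t..s} F - (s - t) * f t\<bar> \<le> e * (s - t)"
        using d1(2)[of "s - t"] greater s by (intro mult) auto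
      then show ?thesis using split[of t s] greater s t by simp
    next
      case less
      have "integral {- t..- t + (t - s)} (\<lambda>x. F (- x)) = integral {s..t} F"
        using Henstock_Kurzweil_Integration.integral_reflect_real[where f = F and a = s and b = t] by simp
      then have "\<bar>integral {s..t} F - (t - s) * f t\<bar> \<le> e * (t - s)"
        using d2(2)[of "t - s"] less s by (intro mult) auto
      moreover have "integral {a..s} f - integral {a..t} f = - integral {s..t} F"
        using split[of s t] less s t by simp
      ultimately show ?thesis using less by (simp add: algebra_simps abs_if split: if_splits)
    qed simp
    then show ?thesis using d1(1) d2(1) by (intro exI[of _ "min d1 d2"]) auto
  qed
  ultimately show ?thesis by (rule that)
qed

text \<open>Lebesgue points: approximate \<open>h t\<close> by an element \<open>d\<close> of a countable set and use the scalar
  theorem for each of the functions \<open>\<lambda>t. norm (h t - d)\<close>.\<close>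

theorem bochner_integral_AE_differentiable:
  fixes h v :: "real \<Rightarrow> 'a::banach"
  assumes T: "T > 0"
    and v: "\<And>t. t \<in> {0..T} \<Longrightarrow> has_strong_bochner_integral (lebesgue_on {0..t}) h (v t)"
    and K: "\<And>t. t \<in> {0..T} \<Longrightarrow> norm (h t) \<le> K"
  shows "AE t in lebesgue_on {0..T}. v differentiable (at t within {0..T})"
proof -
  have h: "strongly_measurable (lebesgue_on {0..T}) h"
    using v[of T] T by (simp add: has_strong_bochner_integral_def)
  interpret L: complete_measure "lebesgue_on {0..T}" by (rule complete_measure_lebesgue_on) simp
  have fin: "finite_measure (lebesgue_on {0..T})" by (rule finite_measure_lebesgue_on) simp
  obtain X where X: "countable X" "AE t in lebesgue_on {0..T}. h t \<in> closure X"
    using h by (rule strongly_measurable_countable_range)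
  have int: "(\<lambda>t. norm (h t - d)) integrable_on {0..T}" for d
  proof -
    have "(\<lambda>t. norm (h t - d)) \<in> borel_measurable (lebesgue_on {0..T})"
      using h by (rule L.strongly_measurable_isCont) (intro continuous_intros)
    moreover have "AE t in lebesgue_on {0..T}. norm (norm (h t - d)) \<le> K + norm d"
      using AE_space
    proof eventually_elim
      case (elim t)
      then show ?case using K[of t] norm_triangle_ineq4[of "h t" d] by simp
    qed
    ultimately have "integrable (lebesgue_on {0..T}) (\<lambda>t. norm (h t - d))"
      by (intro finite_measure.integrable_const_bound[OF fin])
    then show ?thesis by (rule integrable_on_lebesgue_on) simp
  qed
  define \<Psi> where "\<Psi> d s = integral {0..s} (\<lambda>t. norm (h t - d))" for d s
  have "\<exists>N. negligible N \<and> (\<forall>t e. t \<in> {0<..<T} \<longrightarrow> t \<notin> N \<longrightarrow> e > 0 \<longrightarrow>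
      (\<exists>\<eta>>0. \<forall>s\<in>{0..T}. \<bar>s - t\<bar> < \<eta> \<longrightarrow> \<bar>\<Psi> d s - \<Psi> d t - (s - t) * norm (h t - d)\<bar> \<le> e * \<bar>s - t\<bar>))" for d
    unfolding \<Psi>_def by (rule lebesgue_differentiation_interval[OF int[of d]]) blast
  then obtain N where N: "\<And>d. negligible (N d)" "\<And>d t e. t \<in> {0<..<T} \<Longrightarrow> t \<notin> N d \<Longrightarrow> e > 0 \<Longrightarrow>
      \<exists>\<eta>>0. \<forall>s\<in>{0..T}. \<bar>s - t\<bar> < \<eta> \<longrightarrow> \<bar>\<Psi> d s - \<Psi> d t - (s - t) * norm (h t - d)\<bar> \<le> e * \<bar>s - t\<bar>"
    by metis
  \<comment> \<open>The left side is the norm of an integral of h - d, dominated by the integral of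
    the norm. The absolute value on the right covers both orders of s and t.\<close>
  have incr: "norm (v s - v t - (s - t) *\<^sub>R d) \<le> \<bar>\<Psi> d s - \<Psi> d t\<bar>" if st: "s \<in> {0..T}" "t \<in> {0..T}" for s t d
  proof (rule norm_le_functional)
    fix \<phi> :: "'a \<Rightarrow>\<^sub>L real" assume \<phi>: "\<And>y. \<bar>\<phi> y\<bar> \<le> norm y"
    have ineq: "\<bar>\<phi> (v y - v x - (y - x) *\<^sub>R d)\<bar> \<le> \<bar>\<Psi> d y - \<Psi> d x\<bar>"
      if xy: "x \<in> {0..T}" "y \<in> {0..T}" "x \<le> y" for x y
    proof -
      have sub: "{x..y} \<subseteq> {0..y}" "{x..y} \<subseteq> {0..T}" "{0..y} \<subseteq> {0..T}" using xy by auto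
      have hi: "((\<lambda>t. \<phi> (h t)) has_integral \<phi> (v z)) {0..z}" if "z \<in> {0..T}" for z
        using v[OF that] by (rule has_strong_bochner_integral_has_integral) simp
      have "(\<lambda>t. \<phi> (h t)) integrable_on {0..y}" using hi[OF xy(2)] by blast
      then have i1: "(\<lambda>t. \<phi> (h t)) integrable_on {x..y}"
        and c1: "integral {0..x} (\<lambda>t. \<phi> (h t)) + integral {x..y} (\<lambda>t. \<phi> (h t)) = integral {0..y} (\<lambda>t. \<phi> (h t))"
        using xy sub by (auto intro: integrable_on_subinterval Henstock_Kurzweil_Integration.integral_combine)
      have "(\<lambda>t. norm (h t - d)) integrable_on {0..y}"
        using int sub(3) by (rule integrable_on_subinterval)
      then have i2: "(\<lambda>t. norm (h t - d)) integrable_on {x..y}"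
        and c2: "\<Psi> d x + integral {x..y} (\<lambda>t. norm (h t - d)) = \<Psi> d y"
        unfolding \<Psi>_def using xy sub
        by (auto intro: integrable_on_subinterval Henstock_Kurzweil_Integration.integral_combine)
      have "\<phi> (v y - v x - (y - x) *\<^sub>R d) = integral {x..y} (\<lambda>t. \<phi> (h t)) - integral {x..y} (\<lambda>_. \<phi> d)"
        using c1 integral_unique[OF hi[OF xy(1)]] integral_unique[OF hi[OF xy(2)]] xy(3)
        by (simp add: blinfun.diff_right blinfun.scaleR_right)
      also have "\<dots> = integral {x..y} (\<lambda>t. \<phi> (h t) - \<phi> d)"
        using i1 by (intro Henstock_Kurzweil_Integration.integral_diff[symmetric]) auto
      finally have eq: "\<phi> (v y - v x - (y - x) *\<^sub>R d) = integral {x..y} (\<lambda>t. \<phi> (h t) - \<phi> d)" .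
      have "norm (integral {x..y} (\<lambda>t. \<phi> (h t) - \<phi> d)) \<le> integral {x..y} (\<lambda>t. norm (h t - d))"
      proof (rule integral_norm_bound_integral[OF _ i2])
        show "(\<lambda>t. \<phi> (h t) - \<phi> d) integrable_on {x..y}"
          using i1 by (intro Henstock_Kurzweil_Integration.integrable_diff) auto
        show "norm (\<phi> (h t) - \<phi> d) \<le> norm (h t - d)" for t
          using \<phi>[of "h t - d"] by (simp add: blinfun.diff_right)
      qed
      with eq c2 show ?thesis by simp
    qed
    show "\<phi> (v s - v t - (s - t) *\<^sub>R d) \<le> \<bar>\<Psi> d s - \<Psi> d t\<bar>"
    proof (cases "t \<le> s")
      case True
      then show ?thesis using ineq[OF st(2,1)] by linarith
    next
      case False
      have "v s - v t - (s - t) *\<^sub>R d = - (v t - v s - (t - s) *\<^sub>R d)" by (simp add: algebra_simps)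
      then have "\<phi> (v s - v t - (s - t) *\<^sub>R d) = - \<phi> (v t - v s - (t - s) *\<^sub>R d)"
        by (simp only: blinfun.minus_right)
      then show ?thesis using ineq[OF st] False by linarith
    qed
  qed
  have AEN: "AE t in lebesgue_on {0..T}. t \<notin> S" if "negligible S" for S
  proof -
    have "AE t in lebesgue. t \<notin> S" using that by (simp add: AE_not_in negligible_iff_null_sets)
    then show ?thesis by (auto simp: AE_restrict_space_iff)
  qed
  \<comment> \<open>The scalar differentiation result is stated at interior times only.\<close>
  have "AE t in lebesgue_on {0..T}. t \<notin> {0, T}" by (intro AEN negligible_finite) simp
  moreover have "AE t in lebesgue_on {0..T}. \<forall>d\<in>X. t \<notin> N d"
    using X(1) AEN[OF N(1)] by (simp add: AE_ball_countable)
  ultimately show ?thesis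
    using X(2) AE_space
  proof eventually_elim
    case (elim t)
    then have t: "t \<in> {0<..<T}" by auto
    have "(v has_derivative (\<lambda>x. x *\<^sub>R h t)) (at t within {0..T})"
      unfolding has_derivative_within_alt
    proof (intro conjI allI impI)
      show "bounded_linear (\<lambda>x. x *\<^sub>R h t)" by (rule bounded_linear_scaleR_left)
      fix e :: real assume "e > 0"
      \<comment> \<open>Three thirds: the differentiation error of \<Psi>, the main term |s - t|
        times the norm of h(t) - d in the increment of \<Psi>, and the same quantity once more when
        d is replaced by h(t).\<close>
      then have e3: "e / 3 > 0" by simp
      then obtain d where d: "d \<in> X" "norm (h t - d) < e / 3"
        using elim(3) unfolding closure_approachable by (metis dist_norm norm_minus_commute)
      obtain \<eta> where \<eta>: "\<eta> > 0" "\<And>s. s \<in> {0..T} \<Longrightarrow> \<bar>s - t\<bar> < \<eta> \<Longrightarrow>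
          \<bar>\<Psi> d s - \<Psi> d t - (s - t) * norm (h t - d)\<bar> \<le> e / 3 * \<bar>s - t\<bar>"
        using N(2)[OF t _ e3, of d] elim(2) d(1) by blast
      have "norm (v s - v t - (s - t) *\<^sub>R h t) \<le> e * norm (s - t)"
        if s: "s \<in> {0..T}" "norm (s - t) < \<eta>" for s
      proof -
        have "v s - v t - (s - t) *\<^sub>R h t = (v s - v t - (s - t) *\<^sub>R d) - (s - t) *\<^sub>R (h t - d)"
          by (simp add: algebra_simps)
        then have "norm (v s - v t - (s - t) *\<^sub>R h t) \<le>
            norm (v s - v t - (s - t) *\<^sub>R d) + norm ((s - t) *\<^sub>R (h t - d))"
          by (metis norm_triangle_ineq4)
        also have "norm (v s - v t - (s - t) *\<^sub>R d) \<le> \<bar>\<Psi> d s - \<Psi> d t\<bar>"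
          using s(1) t by (intro incr) auto
        also have "\<bar>\<Psi> d s - \<Psi> d t\<bar> \<le> e / 3 * \<bar>s - t\<bar> + \<bar>(s - t) * norm (h t - d)\<bar>"
          using \<eta>(2)[OF s(1)] s(2) abs_triangle_ineq2[of "\<Psi> d s - \<Psi> d t" "(s - t) * norm (h t - d)"]
          unfolding real_norm_def by linarith
        finally have "norm (v s - v t - (s - t) *\<^sub>R h t) \<le>
            e / 3 * \<bar>s - t\<bar> + 2 * (\<bar>s - t\<bar> * norm (h t - d))" by (simp add: abs_mult)
        moreover have "\<bar>s - t\<bar> * norm (h t - d) \<le> \<bar>s - t\<bar> * (e / 3)"
          using d(2) by (intro mult_left_mono) auto
        ultimately show ?thesis by (simp add: algebra_simps)
      qed
      then show "\<exists>\<eta>>0. \<forall>s\<in>{0..T}. norm (s - t) < \<eta> \<longrightarrow>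
          norm (v s - v t - (s - t) *\<^sub>R h t) \<le> e * norm (s - t)"
        using \<eta>(1) by blast
    qed
    then show ?case by (rule differentiableI)
  qed
qed

section \<open>An invariant ball from the growth condition\<close>

lemma real_pow_mono: "0 \<le> x \<Longrightarrow> x \<le> y \<Longrightarrow> 0 \<le> r \<Longrightarrow> real_pow x r \<le> real_pow y r"
  by (simp add: real_pow_def powr_mono2)

lemma real_pow_nonneg: "0 \<le> real_pow x r"
  by (simp add: real_pow_def)

lemma real_pow_pos: "0 < x \<Longrightarrow> real_pow x r = x powr r"
  by (simp add: real_pow_def)

lemma sublinear_growth_radius:
  fixes b c r :: real
  assumes r: "0 \<le> r" "r < 1" and c: "c > 0" and b: "b \<ge> 0"
  obtains x where "x > 0" "c * (real_pow x r + 1) \<le> x - b"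
proof -
  \<comment> \<open>The first entry makes c + b at most x/2; the second makes x^(1 - r) at least 2
    c, so that c x^r is at most x/2.\<close>
  define x where "x = max (2 * (c + b)) ((2 * c) powr (1 / (1 - r)))"
  have x: "x > 0" using c b by (simp add: x_def less_max_iff_disj)
  have "2 * c = ((2 * c) powr (1 / (1 - r))) powr (1 - r)"
    using r c by (simp add: powr_powr)
  also have "\<dots> \<le> x powr (1 - r)" using r by (intro powr_mono2) (auto simp: x_def)
  finally have "2 * c * x powr r \<le> x powr (1 - r) * x powr r" by (intro mult_right_mono) auto
  also have "\<dots> = x" using x by (simp flip: powr_add)
  finally have "c * x powr r \<le> x / 2" by simp
  moreover have "c + b \<le> x / 2" by (simp add: x_def)
  ultimately have "c * (x powr r + 1) \<le> x - b" by (simp add: algebra_simps)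
  then show ?thesis using x by (intro that[of x]) (auto simp: real_pow_pos)
qed

text \<open>For \<open>r \<ge> 1\<close> the given radius works because \<open>T \<le> T^r + 1\<close>; for \<open>r < 1\<close> this inequality may fail,
  but then the growth is sublinear and any large radius will do.\<close>

lemma invariant_radius:
  fixes T C r R b :: real
  assumes T: "T > 0" and C: "C > 0" and r: "r \<ge> 0" and b: "b \<ge> 0"
    and R: "R > b" "C * (real_pow T r + 1) = (R - b) / (real_pow R r + 1)"
  obtains \<rho> where "\<rho> > 0" "C * (real_pow \<rho> r + 1) * T \<le> \<rho> - b"
proof (cases "r < 1")
  case True
  obtain x where "x > 0" "(C * T) * (real_pow x r + 1) \<le> x - b"
    using sublinear_growth_radius[OF r True, of "C * T" b] C T b by auto
  then show ?thesis by (intro that[of x]) (auto simp: mult_ac)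
next
  case False
  have "T \<le> real_pow T r + 1"
  proof (cases "T \<le> 1")
    case True
    then show ?thesis using real_pow_nonneg[of T r] by simp
  next
    case T1: False
    then have "T powr 1 \<le> T powr r" using False by (intro powr_mono) auto
    then show ?thesis using T by (simp add: real_pow_pos)
  qed
  then have "C * (real_pow R r + 1) * T \<le> C * (real_pow R r + 1) * (real_pow T r + 1)"
    using C real_pow_nonneg[of R r] by (intro mult_left_mono) auto
  also have "\<dots> = (C * (real_pow T r + 1)) * (real_pow R r + 1)" by simp
  also have "\<dots> = R - b" using real_pow_nonneg[of R r] unfolding R(2) by simp
  finally show ?thesis using R(1) b by (intro that[of R]) auto
qed

theorem theorem6p2:
  fixes f :: "'a::banach \<Rightarrow> 'a" and g :: "real \<Rightarrow> 'a \<Rightarrow> 'a" and T C r R :: real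
  assumes refl: "reflexive_space TYPE('a)"
    and T: "T > 0"
    and C1: "seq_weakly_continuous f"
    and C2: "1-lipschitz_on UNIV f" "\<forall>u. f differentiable (at u)"
    and C3: "\<forall>u. norm u \<le> norm (u - (f u - f 0))"
            "\<forall>w u. norm w \<le> norm (w - frechet_derivative f (at u) w)"
    and C4: "weak_Caratheodory {0..T} g"
    and C5: "C > 0" "r \<ge> 0" "\<forall>s\<in>{0..T}. \<forall>u. norm (g s u) \<le> C * (real_pow (norm u) r + 1)"
    and C6: "R > norm (f 0)" "C * (real_pow T r + 1) = (R - norm (f 0)) / (real_pow R r + 1)"
  shows "(\<exists>u :: real \<Rightarrow> 'a. (\<exists>L. L-lipschitz_on {0..T} u) \<and> integral_eq_solution T f g u) \<and>
    (\<forall>u :: real \<Rightarrow> 'a. (\<exists>L. L-lipschitz_on {0..T} u) \<and> integral_eq_solution T f g u \<longrightarrow>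
       (AE t in lebesgue_on {0..T}. u differentiable (at t within {0..T})))"
proof -
  have der: "(f has_derivative frechet_derivative f (at u)) (at u)" for u
    using C2(2) frechet_derivative_works by blast
  obtain k where k: "\<And>y. k y - f (k y) = y" "\<And>u. k (u - f u) = u"
      "1-lipschitz_on UNIV k" "\<And>y. k differentiable (at y)"
    and k_weak: "\<And>ys y B. weakly_tendsto ys y \<Longrightarrow> (\<And>n. norm (ys n) \<le> B) \<Longrightarrow>
      weakly_tendsto (\<lambda>n. k (ys n)) (k y)"
    using resolvent[OF refl C1 C2(1) der] C3(2) by metis
  have g_bound: "norm (g s u) \<le> C * (real_pow \<rho> r + 1)" if "s \<in> {0..T}" "norm u \<le> \<rho>" for s u \<rho>
  proof -
    have "norm (g s u) \<le> C * (real_pow (norm u) r + 1)" using C5(3) that(1) by blast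
    also have "\<dots> \<le> C * (real_pow \<rho> r + 1)"
      using C5(1,2) that(2) by (intro mult_left_mono add_right_mono real_pow_mono) auto
    finally show ?thesis .
  qed
  obtain \<rho> where \<rho>: "\<rho> > 0" "C * (real_pow \<rho> r + 1) * T \<le> \<rho> - norm (f 0)"
    using invariant_radius[OF T C5(1,2) norm_ge_zero C6] by blast
  \<comment> \<open>The bound of g on the ball of radius \<rho>; by the choice of \<rho>, M T is at
    most \<rho> - \<open>norm (f 0)\<close>.\<close>
  define M where "M = C * (real_pow \<rho> r + 1)"
  have M: "M \<ge> 0" using C5(1) real_pow_nonneg[of \<rho> r] by (simp add: M_def)
  obtain v where v: "M-lipschitz_on {0..T} v"
    "\<And>t. t \<in> {0..T} \<Longrightarrow> has_strong_bochner_integral (lebesgue_on {0..t}) (\<lambda>s. g s (k (v s))) (v t)"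
  proof (rule weak_ode_existence[OF refl T M, of "\<lambda>t x. g t (k x)"])
    show "strongly_measurable (lebesgue_on {0..T}) (\<lambda>t. g t (k x))" for x
      using C4 by (simp add: weak_Caratheodory_def)
    show "norm (g t (k x)) \<le> M" if "t \<in> {0..T}" "norm x \<le> M * T" for t x
    proof -
      \<comment> \<open>The first inequality of \<open>C3\<close>, at the point k x, eliminates f(k
        x) and leaves only f(0), so the norm of k x is at most M T + \<open>norm (f 0)\<close>,
        hence at most \<rho>.\<close>
      have "k x - (f (k x) - f 0) = x + f 0" using k(1)[of x] by (simp add: algebra_simps)
      then have "norm (k x) \<le> norm (x + f 0)" using C3(1) by metis
      also have "\<dots> \<le> \<rho>" using norm_triangle_ineq[of x "f 0"] that(2) \<rho>(2) by (simp add: M_def)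
      finally show ?thesis unfolding M_def by (rule g_bound[OF that(1)])
    qed
    have "AE t in lebesgue_on {0..T}. seq_weakly_continuous (g t)"
      using C4 by (simp add: weak_Caratheodory_def)
    then show "AE t in lebesgue_on {0..T}. \<forall>xs x B. weakly_tendsto xs x \<longrightarrow> (\<forall>n. norm (xs n) \<le> B) \<longrightarrow>
        weakly_tendsto (\<lambda>n. g t (k (xs n))) (g t (k x))"
    proof eventually_elim
      case (elim t)
      then show ?case using k_weak unfolding seq_weakly_continuous_def by blast
    qed
  qed blast
  have "M-lipschitz_on {0..T} (\<lambda>t. k (v t))"
    using lipschitz_on_compose2[OF v(1), of 1 k] lipschitz_on_subset[OF k(3)] by simp
  moreover have "integral_eq_solution T f g (\<lambda>t. k (v t))"
    unfolding integral_eq_solution_def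
  proof
    fix t assume "t \<in> {0..T}"
    then show "\<exists>J. has_strong_bochner_integral (lebesgue_on {0..t}) (\<lambda>s. g s (k (v s))) J \<and>
        k (v t) = f (k (v t)) + J"
      using v(2) k(1)[of "v t"] by (intro exI[of _ "v t"]) (auto simp: algebra_simps)
  qed
  moreover have "AE t in lebesgue_on {0..T}. u differentiable (at t within {0..T})"
    if L: "L-lipschitz_on {0..T} u" and sol: "integral_eq_solution T f g u" for u :: "real \<Rightarrow> 'a" and L
  proof -
    \<comment> \<open>An arbitrary Lipschitz solution need not stay in the ball of radius \<rho>;
      its own Lipschitz constant supplies a bound, which makes the integrand bounded.\<close>
    have u_bound: "norm (u t) \<le> norm (u 0) + L * T" if "t \<in> {0..T}" for t
    proof -
      have "norm (u t - u 0) \<le> L * t" using lipschitz_onD[OF L, of t 0] that by (simp add: dist_norm)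
      also have "\<dots> \<le> L * T" using lipschitz_on_nonneg[OF L] that by (intro mult_left_mono) auto
      finally show ?thesis using norm_triangle_sub[of "u t" "u 0"] by linarith
    qed
    have "AE t in lebesgue_on {0..T}. (\<lambda>t. u t - f (u t)) differentiable (at t within {0..T})"
    proof (rule bochner_integral_AE_differentiable[OF T])
      show "has_strong_bochner_integral (lebesgue_on {0..t}) (\<lambda>s. g s (u s)) (u t - f (u t))"
        if "t \<in> {0..T}" for t
      proof -
        obtain J where "has_strong_bochner_integral (lebesgue_on {0..t}) (\<lambda>s. g s (u s)) J" "u t = f (u t) + J"
          using sol \<open>t \<in> {0..T}\<close> unfolding integral_eq_solution_def by blast
        then show ?thesis by (metis add_diff_cancel_left')
      qed
      show "norm (g t (u t)) \<le> C * (real_pow (norm (u 0) + L * T) r + 1)" if "t \<in> {0..T}" for t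
        using that u_bound[OF that] by (rule g_bound)
    qed
    then show ?thesis
    proof eventually_elim
      case (elim t)
      \<comment> \<open>u is k applied to u - f(u), and k is differentiable everywhere, so the
        exceptional set does not grow.\<close>
      have "(k \<circ> (\<lambda>t. u t - f (u t))) differentiable (at t within {0..T})"
        by (rule differentiable_chain_within[OF elim differentiable_at_withinI[OF k(4)]])
      then show ?case by (simp add: o_def k(2))
    qed
  qed
  ultimately show ?thesis by blast
qed

end
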